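(* Let $a,b,\kappa,\mu\in\mathbb{R}$, $\alpha,\beta\ge 0$, let $m$ be a positive integer, and let $I=[0,T]$ with $T>0$. Consider the generalized Rosenau-Kawahara-RLW equation in the form $$v_t+k*F(v,\partial_x)=0,\qquad F(v,\partial_x):=a v_x+b v^m v_x+\kappa v_{xxx}-\mu v_{xxxxx},$$ where $k$ is the convolution kernel with $\mathcal{F}(k*f)(\xi)=(1+\alpha\xi^2+\beta\xi^4)^{-1}\mathcal{F}(f)(\xi)$. Assume that this equation admits at most one classical solution $v(t,x)$, $(t,x)\in I\times\mathbb{R}$, for given initial data $v_0(x)=v(0,x)$. If a classical solution $v(t,x)$ is spatially symmetric with axis of symmetry $\lambda(t)$, then $v$ is a steady solution with propagation speed $\dot\lambda(0)$, i.e. there is a function $g$ such that $v(t,x)=g(x-\dot\lambda(0)t)$ for all $(t,x)\in I\times\mathbb{R}$.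
   Context: The equation is equivalent to $Lv_t+F(v,\partial_x)=0$ with $L:=1-\alpha\partial_x^2+\beta\partial_x^4$, i.e. $v_t+a v_x+b v^m v_x+\kappa v_{xxx}-\alpha v_{xxt}+\beta v_{xxxxt}-\mu v_{xxxxx}=0$; $k*$ is the inverse of $L$, with $\mathcal{F}$ the Fourier transform in $x$ on tempered distributions. Classical solutions are sufficiently smooth functions (all derivatives appearing exist and are continuous) satisfying the equation pointwise on $I\times\mathbb{R}$; they are taken to be bounded, so that they can be viewed as tempered distributions in $x$. A function $f(t,x)$ on $I\times\mathbb{R}$ is spatially symmetric if there exists a function $\lambda\in C^1(\mathbb{R})$ (the axis of symmetry) such that $f(t,x)=f(t,2\lambda(t)-x)$ for every $(t,x)\in I\times\mathbb{R}$. A function $f$ is steady (traveling) with speed $c\in\mathbb{R}$ if there is a function $g$ with $f(t,x)=g(x-ct)$ for $(t,x)\in I\times\mathbb{R}$. A dot denotes the derivative in $t$. *)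

theory Defs
  imports "HOL-Analysis.Analysis"
begin

section \<open>Schwartz functions and tempered distributions on the real line\<close>

definition vderiv_iter :: "nat \<Rightarrow> (real \<Rightarrow> complex) \<Rightarrow> real \<Rightarrow> complex" where
  "vderiv_iter j \<phi> = ((\<lambda>f x. vector_derivative f (at x)) ^^ j) \<phi>"

definition schwartz :: "(real \<Rightarrow> complex) set" where
  "schwartz = {\<phi>. (\<forall>j x. vderiv_iter j \<phi> differentiable (at x)) \<and>
                  (\<forall>i j. bounded (range (\<lambda>x. x ^ i *\<^sub>R vderiv_iter j \<phi> x)))}"

definition schwartz_norm :: "nat \<Rightarrow> (real \<Rightarrow> complex) \<Rightarrow> real" where
  "schwartz_norm N \<phi> = (\<Sum>i\<le>N. \<Sum>j\<le>N. (SUP x. norm (x ^ i *\<^sub>R vderiv_iter j \<phi> x)))"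

text \<open>A tempered distribution is a functional of which only the values on \<open>schwartz\<close> matter.\<close>

definition tempered :: "((real \<Rightarrow> complex) \<Rightarrow> complex) \<Rightarrow> bool" where
  "tempered U \<longleftrightarrow>
     (\<forall>\<phi>\<in>schwartz. \<forall>\<psi>\<in>schwartz. \<forall>c. U (\<lambda>x. c * \<phi> x + \<psi> x) = c * U \<phi> + U \<psi>) \<and>
     (\<exists>C N. \<forall>\<phi>\<in>schwartz. norm (U \<phi>) \<le> C * schwartz_norm N \<phi>)"

definition compactly_supported :: "(real \<Rightarrow> complex) \<Rightarrow> bool" where
  "compactly_supported \<phi> \<longleftrightarrow> (\<exists>R. \<forall>x. \<bar>x\<bar> > R \<longrightarrow> \<phi> x = 0)"

text \<open>
  The continuous function \<open>f\<close>, viewed as a tempered distribution, is \<open>U\<close>.  Only compactly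
  supported test functions are used: a derivative of a bounded function is a tempered
  distribution, but as a function it may grow so fast that its product with a general Schwartz
  function is not integrable.  Since the compactly supported functions are dense in \<open>schwartz\<close>,
  at most one tempered distribution represents \<open>f\<close>.
\<close>

definition represents :: "((real \<Rightarrow> complex) \<Rightarrow> complex) \<Rightarrow> (real \<Rightarrow> real) \<Rightarrow> bool" where
  "represents U f \<longleftrightarrow> tempered U \<and>
     (\<forall>\<phi>\<in>schwartz. compactly_supported \<phi> \<longrightarrow>
        U \<phi> = (LINT x|lborel. complex_of_real (f x) * \<phi> x))"

definition fourier :: "(real \<Rightarrow> complex) \<Rightarrow> real \<Rightarrow> complex" where
  "fourier \<phi> \<xi> = (LINT x|lborel. cis (- (\<xi> * x)) * \<phi> x)"

definition fourier_dist ::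
    "((real \<Rightarrow> complex) \<Rightarrow> complex) \<Rightarrow> (real \<Rightarrow> complex) \<Rightarrow> complex" where
  "fourier_dist U = (\<lambda>\<phi>. U (fourier \<phi>))"

definition mult_dist ::
    "(real \<Rightarrow> real) \<Rightarrow> ((real \<Rightarrow> complex) \<Rightarrow> complex) \<Rightarrow> (real \<Rightarrow> complex) \<Rightarrow> complex" where
  "mult_dist s U = (\<lambda>\<phi>. U (\<lambda>\<xi>. complex_of_real (s \<xi>) * \<phi> \<xi>))"

text \<open>
  \<open>K = k * W\<close>, where the Fourier multiplier of \<open>k *\<close> is \<open>1 / (1 + \<alpha> \<xi>\<^sup>2 + \<beta> \<xi>\<^sup>4)\<close>.  As the Fourier
  transform is an automorphism of the tempered distributions, this determines \<open>K\<close> on \<open>schwartz\<close>.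
\<close>

definition is_kernel_conv ::
    "real \<Rightarrow> real \<Rightarrow> ((real \<Rightarrow> complex) \<Rightarrow> complex) \<Rightarrow> ((real \<Rightarrow> complex) \<Rightarrow> complex) \<Rightarrow> bool" where
  "is_kernel_conv \<alpha> \<beta> W K \<longleftrightarrow> tempered K \<and>
     (\<forall>\<phi>\<in>schwartz. fourier_dist K \<phi> =
        mult_dist (\<lambda>\<xi>. 1 / (1 + \<alpha> * \<xi>^2 + \<beta> * \<xi>^4)) (fourier_dist W) \<phi>)"


section \<open>The generalized Rosenau-Kawahara-RLW equation\<close>

text \<open>
  A function on \<open>[0,T] \<times> \<real>\<close> is a curried total function; its values at times outside \<open>[0,T]\<close>
  are irrelevant, and time derivatives are one-sided at the end points.
\<close>

definition dx :: "nat \<Rightarrow> (real \<Rightarrow> real \<Rightarrow> real) \<Rightarrow> real \<Rightarrow> real \<Rightarrow> real" where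
  "dx j v t x = (deriv ^^ j) (v t) x"

definition dt :: "real \<Rightarrow> (real \<Rightarrow> real \<Rightarrow> real) \<Rightarrow> real \<Rightarrow> real \<Rightarrow> real" where
  "dt T v t x = vector_derivative (\<lambda>s. v s x) (at t within {0..T})"

definition flux ::
    "real \<Rightarrow> real \<Rightarrow> real \<Rightarrow> real \<Rightarrow> nat \<Rightarrow> (real \<Rightarrow> real \<Rightarrow> real) \<Rightarrow> real \<Rightarrow> real \<Rightarrow> real" where
  "flux a b \<kappa> \<mu> m v t x =
     a * dx 1 v t x + b * v t x ^ m * dx 1 v t x + \<kappa> * dx 3 v t x - \<mu> * dx 5 v t x"

text \<open>
  The regularity covers the derivatives in
  \<open>v\<^sub>t + a v\<^sub>x + b v\<^sup>m v\<^sub>x + \<kappa> v\<^sub>x\<^sub>x\<^sub>x - \<alpha> v\<^sub>x\<^sub>x\<^sub>t + \<beta> v\<^sub>x\<^sub>x\<^sub>x\<^sub>x\<^sub>t - \<mu> v\<^sub>x\<^sub>x\<^sub>x\<^sub>x\<^sub>x = 0\<close>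
  (and those of intermediate order), whether or not some of the coefficients vanish.
\<close>

definition smooth_solution_class :: "real \<Rightarrow> (real \<Rightarrow> real \<Rightarrow> real) \<Rightarrow> bool" where
  "smooth_solution_class T v \<longleftrightarrow>
     (\<forall>j<5. \<forall>t\<in>{0..T}. \<forall>x. dx j v t field_differentiable (at x)) \<and>
     (\<forall>j\<le>5. continuous_on ({0..T} \<times> UNIV) (\<lambda>(t, x). dx j v t x)) \<and>
     (\<forall>j\<le>4. \<forall>t\<in>{0..T}. \<forall>x. (\<lambda>s. dx j v s x) differentiable (at t within {0..T})) \<and>
     (\<forall>j\<le>4. continuous_on ({0..T} \<times> UNIV) (\<lambda>(t, x). dt T (dx j v) t x))"

text \<open>
  The last clause is the equation \<open>v\<^sub>t + k * F(v, \<partial>\<^sub>x) = 0\<close> at every point: \<open>W\<close> is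
  \<open>F(v, \<partial>\<^sub>x)(t, \<cdot>)\<close> as a tempered distribution, \<open>K = k * W\<close>, and \<open>q\<close> is the function given
  by \<open>K\<close>.  Its continuity, which rules out changes on null sets, is forced by that of \<open>v\<^sub>t\<close>.
\<close>

definition classical_solution ::
    "real \<Rightarrow> real \<Rightarrow> real \<Rightarrow> real \<Rightarrow> real \<Rightarrow> real \<Rightarrow> nat \<Rightarrow> real \<Rightarrow>
     (real \<Rightarrow> real \<Rightarrow> real) \<Rightarrow> bool" where
  "classical_solution a b \<kappa> \<mu> \<alpha> \<beta> m T v \<longleftrightarrow>
     smooth_solution_class T v \<and>
     (\<exists>M. \<forall>t\<in>{0..T}. \<forall>x. \<bar>v t x\<bar> \<le> M) \<and>
     (\<forall>t\<in>{0..T}. \<exists>W K q.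
        represents W (flux a b \<kappa> \<mu> m v t) \<and>
        is_kernel_conv \<alpha> \<beta> W K \<and>
        continuous_on UNIV q \<and> represents K q \<and>
        (\<forall>x. dt T v t x + q x = 0))"

definition at_most_one_classical_solution ::
    "real \<Rightarrow> real \<Rightarrow> real \<Rightarrow> real \<Rightarrow> real \<Rightarrow> real \<Rightarrow> nat \<Rightarrow> real \<Rightarrow> bool" where
  "at_most_one_classical_solution a b \<kappa> \<mu> \<alpha> \<beta> m T \<longleftrightarrow>
     (\<forall>v\<^sub>0 u w.
        classical_solution a b \<kappa> \<mu> \<alpha> \<beta> m T u \<and> (\<forall>x. u 0 x = v\<^sub>0 x) \<and>
        classical_solution a b \<kappa> \<mu> \<alpha> \<beta> m T w \<and> (\<forall>x. w 0 x = v\<^sub>0 x) \<longrightarrow>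
        (\<forall>t\<in>{0..T}. \<forall>x. u t x = w t x))"

definition spatially_symmetric ::
    "real \<Rightarrow> (real \<Rightarrow> real \<Rightarrow> real) \<Rightarrow> (real \<Rightarrow> real) \<Rightarrow> bool" where
  "spatially_symmetric T f lam \<longleftrightarrow>
     lam C1_differentiable_on UNIV \<and>
     (\<forall>t\<in>{0..T}. \<forall>x. f t x = f t (2 * lam t - x))"

definition steady :: "real \<Rightarrow> (real \<Rightarrow> real \<Rightarrow> real) \<Rightarrow> real \<Rightarrow> bool" where
  "steady T f c \<longleftrightarrow> (\<exists>g. \<forall>t\<in>{0..T}. \<forall>x. f t x = g (x - c * t))"

end

theory Submission
  imports Defs "HOL-Probability.Probability"
begin

text \<open>
  Differentiating \<open>v(t, x) = v(t, 2 \<lambda>(t) - x)\<close> in \<open>t\<close> gives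
  \<open>v\<^sub>t(t, x) = v\<^sub>t(t, 2 \<lambda> - x) - 2 \<lambda>' v\<^sub>x(t, x)\<close>.  Every term of \<open>F(v, \<partial>\<^sub>x)\<close> contains an odd number of
  derivatives, so it is odd about the axis, and since the symbol of \<open>k\<close> is even, so is
  \<open>v\<^sub>t = - k * F(v, \<partial>\<^sub>x)\<close>.  Hence \<open>k * F(v, \<partial>\<^sub>x) = \<lambda>' v\<^sub>x\<close>, which at \<open>t = 0\<close> says exactly that the
  travelling wave \<open>v(0, x - \<lambda>'(0) t)\<close> solves the equation; uniqueness identifies it with \<open>v\<close>.

  That \<open>k * F\<close> inherits the oddness of \<open>F\<close> rests on the fact that the function \<open>F\<close> determines
  \<open>k * F\<close>.  As \<open>F\<close> is only tested against compactly supported functions, this needs their density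
  among the Schwartz functions, the invariance of these under the Fourier transform, and the
  inversion formula.
\<close>

section \<open>Smooth, Schwartz and moderately growing functions\<close>

text \<open>Uniqueness of the convolution is proved only for flux 0 (\<open>kernel_conv_0\<close>).
  Oddness follows from it by linearity: adding to \<open>W\<close>, \<open>K\<close> and
  \<open>q\<close> their reflected copies gives a convolution whose flux vanishes, so that
  \<open>q\<close> plus its reflection is 0. Reflection about the axis and translation along the
  wave are both substitutions x -> s x + h with |s| = 1, so one family of lemmas about such maps
  serves the symmetry argument and the travelling wave. No formula for the kernel enters. Only its
  symbol is used, through two properties: it is even, and it is smooth with all derivatives of
  polynomial growth. This treats \<alpha> = 0 or \<beta> = 0 alike, even the case where k is the
  Dirac measure. The travelling wave fits the required regularity exactly: each time derivative of
  v(0, x - c t) costs one derivative in x, so mixed derivatives up to order 4 in x need v(0, x) up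
  to order 5.\<close>

definition vderiv :: "(real \<Rightarrow> complex) \<Rightarrow> real \<Rightarrow> complex" where
  "vderiv f = (\<lambda>x. vector_derivative f (at x))"

definition smooth :: "(real \<Rightarrow> complex) \<Rightarrow> bool" where
  "smooth f \<longleftrightarrow> (\<forall>j x. vderiv_iter j f differentiable (at x))"

definition moderate :: "(real \<Rightarrow> complex) \<Rightarrow> bool" where
  "moderate f \<longleftrightarrow> smooth f \<and> (\<forall>j. \<exists>C n. \<forall>x. norm (vderiv_iter j f x) \<le> C * (1 + \<bar>x\<bar>) ^ n)"

text \<open>
  Membership in \<open>smooth\<close>, \<open>schwartz\<close> and \<open>moderate\<close> is proved coinductively: it suffices to exhibit
  a set of functions that is closed under differentiation and consists of functions with the
  required bounds, which avoids formulas for the iterated derivatives.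
\<close>

definition deriv_closed :: "(real \<Rightarrow> complex) set \<Rightarrow> bool" where
  "deriv_closed A \<longleftrightarrow> (\<forall>f\<in>A. \<exists>f'\<in>A. \<forall>x. (f has_vector_derivative f' x) (at x))"

lemma vderivI: "(\<And>x. (f has_vector_derivative f' x) (at x)) \<Longrightarrow> vderiv f = f'"
  unfolding vderiv_def by (auto intro: vector_derivative_at)

lemma vderiv_iter_0 [simp]: "vderiv_iter 0 f = f"
  by (simp add: vderiv_iter_def)

lemma vderiv_iter_Suc: "vderiv_iter (Suc j) f = vderiv_iter j (vderiv f)"
  by (simp only: vderiv_iter_def vderiv_def funpow_Suc_right o_apply)

lemma vderiv_iter_Suc': "vderiv_iter (Suc j) f = vderiv (vderiv_iter j f)"
  by (simp add: vderiv_iter_def vderiv_def)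

lemma deriv_closed_vderiv:
  assumes "deriv_closed A" "f \<in> A"
  shows "vderiv f \<in> A" "(f has_vector_derivative vderiv f x) (at x)"
proof -
  obtain f' where f': "f' \<in> A" "\<And>x. (f has_vector_derivative f' x) (at x)"
    using assms unfolding deriv_closed_def by blast
  then have "vderiv f = f'" by (intro vderivI)
  with f' show "vderiv f \<in> A" "(f has_vector_derivative vderiv f x) (at x)" by auto
qed

lemma deriv_closed_vderiv_iter:
  assumes "deriv_closed A" "f \<in> A"
  shows "vderiv_iter j f \<in> A"
  by (induction j) (auto simp: vderiv_iter_Suc' assms deriv_closed_vderiv)

lemma deriv_closed_smooth: "deriv_closed A \<Longrightarrow> f \<in> A \<Longrightarrow> smooth f"
  unfolding smooth_def
  using deriv_closed_vderiv(2) deriv_closed_vderiv_iter differentiableI_vector by blast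

lemma smoothD: "smooth f \<Longrightarrow> (f has_vector_derivative vderiv f x) (at x)"
  unfolding smooth_def vderiv_def
  by (metis vderiv_iter_0 vector_derivative_works)

lemma smooth_vderiv: "smooth f \<Longrightarrow> smooth (vderiv f)"
  unfolding smooth_def by (metis vderiv_iter_Suc)

lemma deriv_closed_smooth_set: "deriv_closed (Collect smooth)"
  unfolding deriv_closed_def using smoothD smooth_vderiv by blast

lemma smooth_continuous: "smooth f \<Longrightarrow> continuous_on S f"
  by (meson continuous_at_imp_continuous_on has_vector_derivative_continuous smoothD)

lemma schwartz_iff:
  "f \<in> schwartz \<longleftrightarrow> smooth f \<and> (\<forall>i j. \<exists>C. \<forall>x. \<bar>x\<bar> ^ i * norm (vderiv_iter j f x) \<le> C)"
  by (simp add: schwartz_def smooth_def bounded_iff power_abs)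

lemma schwartz_smooth: "f \<in> schwartz \<Longrightarrow> smooth f"
  by (simp add: schwartz_iff)

lemma schwartz_vderiv: "f \<in> schwartz \<Longrightarrow> vderiv f \<in> schwartz"
  unfolding schwartz_iff by (metis smooth_vderiv vderiv_iter_Suc)

lemma deriv_closed_schwartz: "deriv_closed schwartz"
  unfolding deriv_closed_def using smoothD schwartz_smooth schwartz_vderiv by blast

lemma schwartz_bound: "f \<in> schwartz \<Longrightarrow> \<exists>C. \<forall>x. \<bar>x\<bar> ^ i * norm (f x) \<le> C"
  unfolding schwartz_iff by (metis vderiv_iter_0)

lemma schwartzI:
  assumes "deriv_closed A" "f \<in> A"
    and "\<And>f i. f \<in> A \<Longrightarrow> \<exists>C. \<forall>x. \<bar>x\<bar> ^ i * norm (f x) \<le> C"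
  shows "f \<in> schwartz"
  using assms by (simp add: schwartz_iff deriv_closed_smooth deriv_closed_vderiv_iter)

lemma deriv_closed_moderate: "deriv_closed (Collect moderate)"
  unfolding deriv_closed_def moderate_def
  by (auto intro!: exI[of _ "vderiv _"] smoothD smooth_vderiv simp: vderiv_iter_Suc[symmetric])

lemma moderateI:
  assumes "deriv_closed A" "f \<in> A"
    and "\<And>f. f \<in> A \<Longrightarrow> \<exists>C n. \<forall>x. norm (f x) \<le> C * (1 + \<bar>x\<bar>) ^ n"
  shows "moderate f"
  using assms by (simp add: moderate_def deriv_closed_smooth deriv_closed_vderiv_iter)

lemma moderate_bound: "moderate f \<Longrightarrow> \<exists>C n. \<forall>x. norm (f x) \<le> C * (1 + \<bar>x\<bar>) ^ n"
  unfolding moderate_def by (metis vderiv_iter_0)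

text \<open>Differentiating a product yields a sum of two products, so products alone are not closed
  under differentiation. Adding sums makes the set \<open>deriv_closed\<close> without a Leibniz
  formula of higher order.\<close>

inductive_set product_sums :: "(real \<Rightarrow> complex) set \<Rightarrow> (real \<Rightarrow> complex) set \<Rightarrow> (real \<Rightarrow> complex) set"
  for A B where
    prod: "f \<in> A \<Longrightarrow> g \<in> B \<Longrightarrow> (\<lambda>x. f x * g x) \<in> product_sums A B"
  | sum: "f \<in> product_sums A B \<Longrightarrow> g \<in> product_sums A B \<Longrightarrow> (\<lambda>x. f x + g x) \<in> product_sums A B"

lemma deriv_closed_product_sums:
  assumes A: "deriv_closed A" and B: "deriv_closed B"
  shows "deriv_closed (product_sums A B)"
  unfolding deriv_closed_def
proof
  fix h assume "h \<in> product_sums A B"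
  then show "\<exists>h'\<in>product_sums A B. \<forall>x. (h has_vector_derivative h' x) (at x)"
  proof induction
    case (prod f g)
    note f = deriv_closed_vderiv[OF A prod(1)] and g = deriv_closed_vderiv[OF B prod(2)]
    show ?case
    proof (intro bexI allI)
      show "((\<lambda>x. f x * g x) has_vector_derivative f x * vderiv g x + vderiv f x * g x) (at x)" for x
        by (intro has_vector_derivative_mult f g)
      show "(\<lambda>x. f x * vderiv g x + vderiv f x * g x) \<in> product_sums A B"
        using prod f(1) g(1) by (intro product_sums.intros)
    qed
  next
    case (sum f g)
    then obtain f' g' where "f' \<in> product_sums A B" "g' \<in> product_sums A B"
      "\<And>x. (f has_vector_derivative f' x) (at x)" "\<And>x. (g has_vector_derivative g' x) (at x)"
      by blast
    then show ?case
      by (intro bexI[of _ "\<lambda>x. f' x + g' x"]) (auto intro: product_sums.sum has_vector_derivative_add)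
  qed
qed

lemma smooth_mult: "smooth f \<Longrightarrow> smooth g \<Longrightarrow> smooth (\<lambda>x. f x * g x)"
  using deriv_closed_smooth[OF deriv_closed_product_sums[OF deriv_closed_smooth_set deriv_closed_smooth_set]]
  by (simp add: product_sums.prod)

lemma product_sums_bound:
  assumes "h \<in> product_sums (Collect moderate) schwartz"
  shows "\<exists>C. \<forall>x. \<bar>x\<bar> ^ i * norm (h x) \<le> C"
  using assms
proof induction
  case (prod f g)
  obtain C n where C: "\<And>x. norm (f x) \<le> C * (1 + \<bar>x\<bar>) ^ n"
    using moderate_bound prod by blast
  obtain D0 where D0: "\<And>x. \<bar>x\<bar> ^ i * norm (g x) \<le> D0"
    using schwartz_bound prod by blast
  obtain D1 where D1: "\<And>x. \<bar>x\<bar> ^ (n + i) * norm (g x) \<le> D1"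
    using schwartz_bound prod by blast
  have "C \<ge> 0" using order_trans[OF norm_ge_zero C[of 0]] by simp
  have "\<bar>x\<bar> ^ i * norm (f x * g x) \<le> C * (2 ^ n * (D0 + D1))" for x
  proof -
    \<comment> \<open>This turns polynomial growth of \<open>f\<close> into the two monomial weights
      1 and |x|^n, both of which the decay of \<open>g\<close> absorbs.\<close>
    have "(1 + \<bar>x\<bar>) ^ n \<le> 2 ^ n * (1 + \<bar>x\<bar> ^ n)"
    proof (cases "\<bar>x\<bar> \<le> 1")
      case True
      then have "(1 + \<bar>x\<bar>) ^ n \<le> 2 ^ n" by (intro power_mono) auto
      also have "\<dots> \<le> 2 ^ n * (1 + \<bar>x\<bar> ^ n)" by (simp add: field_simps)
      finally show ?thesis .
    next
      case False
      then have "(1 + \<bar>x\<bar>) ^ n \<le> (2 * \<bar>x\<bar>) ^ n" by (intro power_mono) auto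
      then show ?thesis by (simp add: power_mult_distrib distrib_left add_increasing)
    qed
    then have "norm (f x) \<le> C * (2 ^ n * (1 + \<bar>x\<bar> ^ n))"
      using C[of x] \<open>C \<ge> 0\<close> by (meson mult_left_mono order_trans)
    then have "\<bar>x\<bar> ^ i * norm (f x * g x) \<le> \<bar>x\<bar> ^ i * (C * (2 ^ n * (1 + \<bar>x\<bar> ^ n)) * norm (g x))"
      by (simp add: norm_mult mult_left_mono mult_right_mono)
    also have "\<dots> = C * (2 ^ n * (\<bar>x\<bar> ^ i * norm (g x) + \<bar>x\<bar> ^ (n + i) * norm (g x)))"
      by (simp add: algebra_simps power_add)
    also have "\<dots> \<le> C * (2 ^ n * (D0 + D1))"
      using \<open>C \<ge> 0\<close> D0[of x] D1[of x] by (intro mult_left_mono add_mono) auto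
    finally show ?thesis .
  qed
  then show ?case by blast
next
  case (sum f g)
  then obtain C D where "\<And>x. \<bar>x\<bar> ^ i * norm (f x) \<le> C" "\<And>x. \<bar>x\<bar> ^ i * norm (g x) \<le> D"
    by blast
  then have CD: "\<bar>x\<bar> ^ i * norm (f x) + \<bar>x\<bar> ^ i * norm (g x) \<le> C + D" for x
    by (intro add_mono)
  have "\<bar>x\<bar> ^ i * norm (f x + g x) \<le> C + D" for x
    by (rule order_trans[OF _ CD[of x]]) (simp add: mult_left_mono norm_triangle_ineq flip: distrib_left)
  then show ?case by blast
qed

lemma schwartz_mult: "moderate f \<Longrightarrow> g \<in> schwartz \<Longrightarrow> (\<lambda>x. f x * g x) \<in> schwartz"
  by (rule schwartzI[OF deriv_closed_product_sums[OF deriv_closed_moderate deriv_closed_schwartz]])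
     (auto intro: product_sums.prod product_sums_bound)

section \<open>Concrete functions of moderate growth\<close>

lemma moderate_const: "moderate (\<lambda>_. c)"
proof (rule moderateI)
  show "deriv_closed {\<lambda>_. c, \<lambda>_. 0}"
    unfolding deriv_closed_def by auto
  show "\<exists>C n. \<forall>x. norm (f x) \<le> C * (1 + \<bar>x\<bar>) ^ n" if "f \<in> {\<lambda>_. c, \<lambda>_. 0}" for f
    using that by (intro exI[of _ "norm c"] exI[of _ 0]) auto
qed auto

lemma schwartz_cmult: "f \<in> schwartz \<Longrightarrow> (\<lambda>x. c * f x) \<in> schwartz"
  by (rule schwartz_mult[OF moderate_const])

lemma schwartz_add:
  assumes "f \<in> schwartz" "g \<in> schwartz"
  shows "(\<lambda>x. f x + g x) \<in> schwartz"
proof -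
  have "(\<lambda>x. 1 * f x + 1 * g x) \<in> product_sums (Collect moderate) schwartz"
    using assms by (intro product_sums.intros) (auto intro: moderate_const)
  then show ?thesis
    using schwartzI[OF deriv_closed_product_sums[OF deriv_closed_moderate deriv_closed_schwartz] _ product_sums_bound]
    by auto
qed

lemma moderate_id: "moderate complex_of_real"
proof (rule moderateI)
  let ?A = "{complex_of_real, \<lambda>_. 1, \<lambda>_. 0}"
  have "(complex_of_real has_vector_derivative 1) (at x)" for x
    using has_vector_derivative_of_real[OF DERIV_ident] by simp
  then show "deriv_closed ?A"
    unfolding deriv_closed_def by auto
  show "\<exists>C n. \<forall>x. norm (f x) \<le> C * (1 + \<bar>x\<bar>) ^ n" if "f \<in> ?A" for f
    using that by (intro exI[of _ 1] exI[of _ 1]) auto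
qed auto

lemma moderate_cis: "moderate (\<lambda>x. cis (h * x))"
proof (rule moderateI)
  let ?A = "range (\<lambda>c x. c * cis (h * x))"
  show "deriv_closed ?A"
    unfolding deriv_closed_def
  proof safe
    fix c :: complex
    show "\<exists>f'\<in>?A. \<forall>x. ((\<lambda>x. c * cis (h * x)) has_vector_derivative f' x) (at x)"
      by (rule bexI[of _ "\<lambda>x. (c * (\<i> * h)) * cis (h * x)"])
         (auto simp: cis_conv_exp intro!: derivative_eq_intros has_vector_derivative_real_field)
  qed
  show "\<exists>C n. \<forall>x. norm (f x) \<le> C * (1 + \<bar>x\<bar>) ^ n" if A: "f \<in> ?A" for f
  proof -
    obtain c where "f = (\<lambda>x. c * cis (h * x))" using A by blast
    then show ?thesis by (intro exI[of _ "norm c"] exI[of _ 0]) (auto simp: norm_mult)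
  qed
  show "(\<lambda>x. cis (h * x)) \<in> ?A"
    by (intro range_eqI[of _ _ 1]) auto
qed

text \<open>The functions p / Q^n, with Q the denominator and p any polynomial, are closed under
  differentiation. Nonnegative coefficients give Q \<ge> 1, so each of them is bounded by
  |p|.\<close>

lemma moderate_multiplier:
  fixes \<alpha> \<beta> :: real
  assumes "\<alpha> \<ge> 0" "\<beta> \<ge> 0"
  shows "moderate (\<lambda>x. complex_of_real (1 / (1 + \<alpha> * x^2 + \<beta> * x^4)))"
proof (rule moderateI)
  define Q where "Q = [:1, 0, \<alpha>, 0, \<beta>:]"
  have Q: "poly Q x = 1 + \<alpha> * x^2 + \<beta> * x^4" for x
    by (simp add: Q_def power2_eq_square power4_eq_xxxx algebra_simps)
  have Q1: "poly Q x \<ge> 1" for x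
    using assms by (simp add: Q)
  let ?A = "{\<lambda>x. complex_of_real (poly p x / poly Q x ^ n) | p n. True}"
  show "deriv_closed ?A"
    unfolding deriv_closed_def
  proof safe
    fix p n
    have "((\<lambda>x. poly p x / poly Q x ^ n) has_real_derivative
       (poly (pderiv p * Q - smult (of_nat n) (p * pderiv Q)) x / poly Q x ^ Suc n)) (at x)" for x
    proof -
      have nz: "poly Q x \<noteq> 0" using Q1[of x] by auto
      have "((\<lambda>x. poly Q x ^ n) has_real_derivative of_nat n * (poly (pderiv Q) x * poly Q x ^ (n - Suc 0))) (at x)"
        by (rule DERIV_power[OF poly_DERIV])
      from DERIV_divide[OF poly_DERIV this] nz
      have "((\<lambda>x. poly p x / poly Q x ^ n) has_real_derivative
         (poly (pderiv p) x * poly Q x ^ n - poly p x * (of_nat n * (poly (pderiv Q) x * poly Q x ^ (n - Suc 0)))) /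
         (poly Q x ^ n * poly Q x ^ n)) (at x)" by simp
      then show ?thesis
        \<comment> \<open>The power rule contains the truncated exponent \<open>n - Suc 0\<close>,
          so n = 0 has to be treated apart.\<close>
        by (rule DERIV_cong) (use nz in \<open>cases n; simp add: field_simps\<close>)
    qed
    then have "((\<lambda>x. complex_of_real (poly p x / poly Q x ^ n)) has_vector_derivative
       complex_of_real (poly (pderiv p * Q - smult (of_nat n) (p * pderiv Q)) x / poly Q x ^ Suc n)) (at x)" for x
      by (rule has_vector_derivative_of_real)
    then show "\<exists>f'\<in>?A. \<forall>x. ((\<lambda>x. complex_of_real (poly p x / poly Q x ^ n)) has_vector_derivative f' x) (at x)"
      by (intro bexI[of _ "\<lambda>x. complex_of_real (poly (pderiv p * Q - smult (of_nat n) (p * pderiv Q)) x / poly Q x ^ Suc n)"])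
         blast+
  qed
  show "\<exists>C n. \<forall>x. norm (f x) \<le> C * (1 + \<bar>x\<bar>) ^ n" if A: "f \<in> ?A" for f
  proof -
    obtain p n where f: "f = (\<lambda>x. complex_of_real (poly p x / poly Q x ^ n))"
      using A by blast
    have "\<exists>C. \<forall>x. \<bar>poly p x\<bar> \<le> C * (1 + \<bar>x\<bar>) ^ degree p"
    proof (induction p)
      case 0
      then show ?case by auto
    next
      case (pCons a p)
      then obtain C where C: "\<And>x. \<bar>poly p x\<bar> \<le> C * (1 + \<bar>x\<bar>) ^ degree p" by auto
      have "C \<ge> 0" using C[of 0] by auto
      show ?case
      proof (cases "p = 0")
        case False
        have "\<bar>poly (pCons a p) x\<bar> \<le> (\<bar>a\<bar> + C) * (1 + \<bar>x\<bar>) ^ degree (pCons a p)" for x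
        proof -
          have 1: "1 \<le> (1 + \<bar>x\<bar>) ^ degree (pCons a p)" by simp
          have "\<bar>poly (pCons a p) x\<bar> \<le> \<bar>a\<bar> * 1 + \<bar>x\<bar> * \<bar>poly p x\<bar>"
            by (simp add: abs_mult[symmetric])
          also have "\<dots> \<le> \<bar>a\<bar> * (1 + \<bar>x\<bar>) ^ degree (pCons a p) + (1 + \<bar>x\<bar>) * (C * (1 + \<bar>x\<bar>) ^ degree p)"
            using C[of x] 1 by (intro add_mono mult_mono) auto
          finally show ?thesis using False by (simp add: algebra_simps)
        qed
        then show ?thesis by blast
      qed (auto intro!: exI[of _ "\<bar>a\<bar>"])
    qed
    then obtain C where C: "\<And>x. \<bar>poly p x\<bar> \<le> C * (1 + \<bar>x\<bar>) ^ degree p" by auto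
    have "norm (f x) \<le> \<bar>poly p x\<bar>" for x
      using Q1[of x] by (simp add: f norm_divide norm_power divide_le_eq mult_left_le one_le_power mult_le_cancel_left1 del: of_real_divide)
    with C show ?thesis by (meson order_trans)
  qed
  show "(\<lambda>x. complex_of_real (1 / (1 + \<alpha> * x^2 + \<beta> * x^4))) \<in> ?A"
    by (auto simp: Q intro!: exI[of _ 1] exI[of _ 1])
qed

text \<open>The chain rule produces a factor s at each differentiation; the free constant c collects
  these factors.\<close>

lemma deriv_closed_affine:
  assumes "deriv_closed A"
  shows "deriv_closed {\<lambda>x. complex_of_real c * f (s * x + h) | c f. f \<in> A}" (is "deriv_closed ?A")
  unfolding deriv_closed_def
proof safe
  fix c f assume f: "f \<in> A"
  note f' = deriv_closed_vderiv[OF assms f]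
  have "((\<lambda>x. complex_of_real c * f (s * x + h)) has_vector_derivative
      complex_of_real (c * s) * vderiv f (s * x + h)) (at x)" for x
  proof -
    have "((\<lambda>x. s * x + h) has_real_derivative s) (at x)"
      by (auto intro!: derivative_eq_intros)
    then have "(f \<circ> (\<lambda>x. s * x + h) has_vector_derivative s *\<^sub>R vderiv f (s * x + h)) (at x)"
      by (intro vector_diff_chain_at f'(2)) (simp add: has_real_derivative_iff_has_vector_derivative)
    from has_vector_derivative_mult_right[OF this, of "complex_of_real c"]
    show ?thesis by (simp add: o_def scaleR_conv_of_real mult.assoc)
  qed
  then show "\<exists>f'\<in>?A. \<forall>x. ((\<lambda>x. complex_of_real c * f (s * x + h)) has_vector_derivative f' x) (at x)"
    using f'(1) by (intro bexI[of _ "\<lambda>x. complex_of_real (c * s) * vderiv f (s * x + h)"]) blast+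
qed

section \<open>Rules for iterated derivatives\<close>

lemma smooth_affine: "smooth f \<Longrightarrow> smooth (\<lambda>x. f (s * x + h))"
  by (rule deriv_closed_smooth[OF deriv_closed_affine[OF deriv_closed_smooth_set]])
     (auto intro!: exI[of _ 1])

lemma vderiv_affine:
  assumes "smooth f"
  shows "vderiv (\<lambda>x. f (s * x + h)) = (\<lambda>x. complex_of_real s * vderiv f (s * x + h))"
proof (rule vderivI)
  fix x
  have "((\<lambda>x. s * x + h) has_real_derivative s) (at x)"
    by (auto intro!: derivative_eq_intros)
  then have "(f \<circ> (\<lambda>x. s * x + h) has_vector_derivative s *\<^sub>R vderiv f (s * x + h)) (at x)"
    by (intro vector_diff_chain_at smoothD assms) (simp add: has_real_derivative_iff_has_vector_derivative)
  then show "((\<lambda>x. f (s * x + h)) has_vector_derivative complex_of_real s * vderiv f (s * x + h)) (at x)"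
    by (simp add: o_def scaleR_conv_of_real)
qed

lemma smooth_cmult: "smooth f \<Longrightarrow> smooth (\<lambda>x. c * f x)"
  using moderate_const unfolding moderate_def by (intro smooth_mult) auto

lemma smooth_add:
  assumes "smooth f" "smooth g"
  shows "smooth (\<lambda>x. f x + g x)"
proof -
  have "smooth (\<lambda>_. 1)" using moderate_const moderate_def by auto
  then have "(\<lambda>x. 1 * f x + 1 * g x) \<in> product_sums (Collect smooth) (Collect smooth)"
    using assms by (intro product_sums.intros) auto
  then show ?thesis
    using deriv_closed_smooth[OF deriv_closed_product_sums[OF deriv_closed_smooth_set deriv_closed_smooth_set]]
    by auto
qed

lemma vderiv_cmult: "smooth f \<Longrightarrow> vderiv (\<lambda>x. c * f x) = (\<lambda>x. c * vderiv f x)"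
  by (intro vderivI has_vector_derivative_mult_right smoothD)

lemma vderiv_add: "smooth f \<Longrightarrow> smooth g \<Longrightarrow> vderiv (\<lambda>x. f x + g x) = (\<lambda>x. vderiv f x + vderiv g x)"
  by (intro vderivI has_vector_derivative_add smoothD)

lemma vderiv_mult:
  "smooth f \<Longrightarrow> smooth g \<Longrightarrow> vderiv (\<lambda>x. f x * g x) = (\<lambda>x. f x * vderiv g x + vderiv f x * g x)"
  by (intro vderivI has_vector_derivative_mult smoothD)

lemma vderiv_iter_cmult: "smooth f \<Longrightarrow> vderiv_iter j (\<lambda>x. c * f x) = (\<lambda>x. c * vderiv_iter j f x)"
  by (induction j arbitrary: f) (auto simp: vderiv_iter_Suc vderiv_cmult smooth_vderiv)

lemma vderiv_iter_add:
  "smooth f \<Longrightarrow> smooth g \<Longrightarrow> vderiv_iter j (\<lambda>x. f x + g x) = (\<lambda>x. vderiv_iter j f x + vderiv_iter j g x)"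
  by (induction j arbitrary: f g) (auto simp: vderiv_iter_Suc vderiv_add smooth_vderiv)

lemma vderiv_iter_affine:
  "smooth f \<Longrightarrow> vderiv_iter j (\<lambda>x. f (s * x + h)) = (\<lambda>x. complex_of_real (s ^ j) * vderiv_iter j f (s * x + h))"
  by (induction j arbitrary: f)
     (auto simp: vderiv_iter_Suc vderiv_affine smooth_vderiv smooth_affine vderiv_iter_cmult)


section \<open>The Fourier transform on Schwartz functions\<close>

lemma schwartz_continuous: "f \<in> schwartz \<Longrightarrow> continuous_on S f"
  by (intro smooth_continuous schwartz_smooth)

lemma schwartz_measurable: "f \<in> schwartz \<Longrightarrow> f \<in> borel_measurable borel"
  by (intro borel_measurable_continuous_onI schwartz_continuous)

lemma schwartz_integrable:
  assumes "f \<in> schwartz"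
  shows "integrable lborel f"
proof -
  obtain C D where C: "\<And>x. \<bar>x\<bar> ^ 0 * norm (f x) \<le> C" and D: "\<And>x. \<bar>x\<bar> ^ 2 * norm (f x) \<le> D"
    using schwartz_bound[OF assms] by metis
  have "integrable lborel (\<lambda>x::real. (C + D) * inverse (1 + x^2))"
    using integrable_inverse_1_plus_square by (simp add: set_integrable_def)
  then show ?thesis
  proof (rule Bochner_Integration.integrable_bound)
    show "AE x in lborel. norm (f x) \<le> norm ((C + D) * inverse (1 + x^2))"
    proof (rule AE_I2)
      fix x
      have "norm (f x) * (1 + x^2) \<le> C + D"
        using C[of x] D[of x] by (simp add: algebra_simps)
      then show "norm (f x) \<le> norm ((C + D) * inverse (1 + x^2))"
        by (simp add: field_simps add_pos_nonneg order_trans[OF _ abs_ge_self])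
    qed
  qed (simp add: schwartz_measurable assms)
qed

lemma cis_measurable [measurable]: "cis \<in> borel_measurable borel"
  by (intro borel_measurable_continuous_onI continuous_intros)

lemma integrable_cis_mult:
  assumes "integrable lborel f"
  shows "integrable lborel (\<lambda>x. cis (- (\<xi> * x)) * f x)"
  using assms by (rule Bochner_Integration.integrable_bound) (use assms in \<open>auto simp: norm_mult\<close>)

lemma norm_fourier_le: "norm (fourier f \<xi>) \<le> (LINT x|lborel. norm (f x))"
  unfolding fourier_def
  by (rule order_trans[OF integral_norm_bound]) (simp add: norm_mult)

lemma fourier_cmult: "fourier (\<lambda>x. c * f x) \<xi> = c * fourier f \<xi>"
  unfolding fourier_def by (simp add: mult.left_commute[of _ c])

text \<open>Differentiation under the integral sign by an explicit Taylor estimate: |exp(-i h x) - 1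
  + i h x| \<le> (h x)^2 / 2. The error of the difference quotient is therefore at most K |h|, where
  K is half the second absolute moment of \<open>f\<close>.\<close>

lemma fourier_has_vector_derivative:
  fixes f :: "real \<Rightarrow> complex"
  assumes f: "f \<in> schwartz"
  shows "(fourier f has_vector_derivative fourier (\<lambda>x. - \<i> * (complex_of_real x * f x)) \<xi>) (at \<xi>)"
proof -
  let ?g = "\<lambda>x. - \<i> * (complex_of_real x * f x)"
  have g: "?g \<in> schwartz"
    by (intro schwartz_cmult schwartz_mult moderate_id f)
  have "(\<lambda>x. complex_of_real x * (complex_of_real x * f x)) \<in> schwartz"
    by (intro schwartz_mult moderate_id f)
  from integrable_norm[OF schwartz_integrable[OF this]]
  have i2: "integrable lborel (\<lambda>x. x^2 * norm (f x))"
    by (simp add: norm_mult power2_eq_square flip: mult.assoc)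
  define K where "K = (LINT x|lborel. x^2 * norm (f x)) / 2"
  have int: "integrable lborel (\<lambda>x. cis (- (\<eta> * x)) * f x)"
    "integrable lborel (\<lambda>x. cis (- (\<eta> * x)) * ?g x)" for \<eta>
    by (intro integrable_cis_mult schwartz_integrable f g)+
  show ?thesis
    unfolding has_vector_derivative_def
  proof (rule has_derivativeI_sandwich[where e = 1 and H = "\<lambda>\<eta>. K * norm (\<eta> - \<xi>)"])
    show "((\<lambda>\<eta>. K * norm (\<eta> - \<xi>)) \<longlongrightarrow> 0) (at \<xi>)"
      by (rule tendsto_eq_intros refl | simp)+
    fix \<eta> :: real assume "\<eta> \<noteq> \<xi>"
    define h where "h = \<eta> - \<xi>"
    define R where "R x = cis (- (\<eta> * x)) * f x - cis (- (\<xi> * x)) * f x - h *\<^sub>R (cis (- (\<xi> * x)) * ?g x)" for x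
    have R_eq: "R x = cis (- (\<xi> * x)) * ((cis (- (h * x)) - 1 + \<i> * (h * x)) * f x)" for x
    proof -
      have "cis (- (\<eta> * x)) = cis (- (\<xi> * x)) * cis (- (h * x))"
        by (simp add: cis_mult h_def algebra_simps)
      then show ?thesis by (simp add: R_def algebra_simps scaleR_conv_of_real)
    qed
    have R_int: "integrable lborel R"
      unfolding R_def by (intro Bochner_Integration.integrable_diff integrable_scaleR_right impI int)
    have eq: "fourier f \<eta> - fourier f \<xi> - h *\<^sub>R fourier ?g \<xi> = (LINT x|lborel. R x)"
      unfolding fourier_def R_def
      using Bochner_Integration.integral_diff[OF Bochner_Integration.integrable_diff[OF int(1)[of \<eta>] int(1)[of \<xi>]]
          integrable_scaleR_right[OF int(2)[of \<xi>], of h]]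
        Bochner_Integration.integral_diff[OF int(1)[of \<eta>] int(1)[of \<xi>]]
      by (simp only: integral_scaleR_right)
    have "norm (fourier f \<eta> - fourier f \<xi> - h *\<^sub>R fourier ?g \<xi>) \<le> (LINT x|lborel. norm (R x))"
      unfolding eq by (rule integral_norm_bound)
    also have "\<dots> \<le> (LINT x|lborel. h^2 / 2 * (x^2 * norm (f x)))"
    proof (rule integral_mono)
      show "integrable lborel (\<lambda>x. norm (R x))" "integrable lborel (\<lambda>x. h^2 / 2 * (x^2 * norm (f x)))"
        using i2 R_int by simp_all
      fix x
      have "norm (cis (- (h * x)) - 1 + \<i> * (h * x)) \<le> (h * x)^2 / 2"
        using iexp_approx1[of "- (h * x)" 1]
        by (simp add: cis_conv_exp power2_eq_square algebra_simps)
      then have "norm (cis (- (h * x)) - 1 + \<i> * (h * x)) * norm (f x) \<le> (h * x)^2 / 2 * norm (f x)"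
        by (rule mult_right_mono) simp
      then show "norm (R x) \<le> h^2 / 2 * (x^2 * norm (f x))"
        by (simp add: R_eq norm_mult power_mult_distrib)
    qed
    also have "\<dots> = K * \<bar>h\<bar> * \<bar>h\<bar>"
      using i2 by (simp add: K_def power2_eq_square mult.assoc)
    finally show "norm (fourier f \<eta> - fourier f \<xi> - (\<eta> - \<xi>) *\<^sub>R fourier ?g \<xi>) / norm (\<eta> - \<xi>) \<le> K * norm (\<eta> - \<xi>)"
      using \<open>\<eta> \<noteq> \<xi>\<close> by (simp add: h_def[symmetric] divide_le_eq mult.assoc)
  qed (auto intro: bounded_linear_scaleR_left)
qed

lemma schwartz_tendsto_0:
  assumes "f \<in> schwartz" "F \<le> at_infinity"
  shows "(f \<longlongrightarrow> 0) F"
proof -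
  obtain C where C: "\<And>x. \<bar>x\<bar> ^ 1 * norm (f x) \<le> C"
    using schwartz_bound assms by metis
  have "(f \<longlongrightarrow> 0) at_infinity"
  proof (rule Lim_null_comparison)
    show "eventually (\<lambda>x. norm (f x) \<le> C * norm (inverse x)) at_infinity"
      using eventually_not_equal_at_infinity[of 0]
      by eventually_elim (use C in \<open>simp add: field_simps\<close>)
    show "((\<lambda>x::real. C * norm (inverse x)) \<longlongrightarrow> 0) at_infinity"
      using tendsto_inverse_0 by (intro tendsto_mult_right_zero tendsto_norm_zero)
  qed
  then show ?thesis using assms tendsto_mono by blast
qed

lemma integral_vderiv_schwartz:
  assumes f: "f \<in> schwartz"
  shows "(LINT x|lborel. vderiv f x) = 0"
proof -
  have "(LBINT x=-\<infinity>..\<infinity>. vderiv f x) = 0 - 0"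
  proof (rule interval_integral_FTC_integrable[where F = f])
    show "isCont (vderiv f) x" for x
      using schwartz_continuous[OF schwartz_vderiv[OF f], of UNIV] continuous_on_eq_continuous_at by blast
    show "set_integrable lborel (einterval (- \<infinity>) \<infinity>) (vderiv f)"
      using schwartz_integrable[OF schwartz_vderiv[OF f]] by (simp add: set_integrable_def)
    show "((f \<circ> real_of_ereal) \<longlongrightarrow> 0) (at_right (- \<infinity>))" "((f \<circ> real_of_ereal) \<longlongrightarrow> 0) (at_left \<infinity>)"
      unfolding ereal_tendsto_simps
      by (intro schwartz_tendsto_0 f at_bot_le_at_infinity at_top_le_at_infinity)+
  qed (auto intro: smoothD schwartz_smooth f)
  then show ?thesis
    by (simp add: interval_lebesgue_integral_def set_lebesgue_integral_def)
qed

text \<open>Integration by parts without boundary terms: the derivative of the Schwartz function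
  exp(-i \<xi> x) f(x) has integral 0.\<close>

lemma fourier_vderiv:
  assumes f: "f \<in> schwartz"
  shows "fourier (vderiv f) \<xi> = \<i> * \<xi> * fourier f \<xi>"
proof -
  let ?e = "\<lambda>x. cis (- \<xi> * x)"
  have e: "(?e has_vector_derivative - \<i> * \<xi> * ?e x) (at x)" for x
    by (auto simp: cis_conv_exp intro!: derivative_eq_intros has_vector_derivative_real_field)
  have "vderiv (\<lambda>x. ?e x * f x) = (\<lambda>x. ?e x * vderiv f x + - \<i> * \<xi> * ?e x * f x)"
    by (intro vderivI has_vector_derivative_mult e smoothD schwartz_smooth f)
  then have "0 = (LINT x|lborel. ?e x * vderiv f x + - \<i> * \<xi> * (?e x * f x))"
    using integral_vderiv_schwartz[OF schwartz_mult[OF moderate_cis f, of "- \<xi>"]] by (simp add: mult.assoc)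
  also have "\<dots> = fourier (vderiv f) \<xi> + - \<i> * \<xi> * fourier f \<xi>"
    unfolding fourier_def
    using integrable_cis_mult[OF schwartz_integrable[OF f], of \<xi>]
      integrable_cis_mult[OF schwartz_integrable[OF schwartz_vderiv[OF f]], of \<xi>]
    by (subst Bochner_Integration.integral_add) (simp_all add: mult.commute[of \<xi>])
  finally show ?thesis by (simp add: algebra_simps)
qed

text \<open>Transforms are closed under differentiation, because the derivative is the transform of
  -i x f(x). For the decay, each power of \<xi> is exchanged for a derivative of \<open>f\<close>,
  down to the bound by the integral of |f|.\<close>

lemma fourier_schwartz:
  assumes "f \<in> schwartz"
  shows "fourier f \<in> schwartz"
proof (rule schwartzI)
  show "deriv_closed (fourier ` schwartz)"
    unfolding deriv_closed_def
  proof safe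
    fix f assume f: "f \<in> schwartz"
    have "(\<lambda>x. - \<i> * (complex_of_real x * f x)) \<in> schwartz"
      by (intro schwartz_cmult schwartz_mult moderate_id f)
    then show "\<exists>f'\<in>fourier ` schwartz. \<forall>x. (fourier f has_vector_derivative f' x) (at x)"
      using fourier_has_vector_derivative[OF f] by (intro bexI) (rule allI, assumption, rule imageI)
  qed
  show "\<exists>C. \<forall>x. \<bar>x\<bar> ^ i * norm (g x) \<le> C" if "g \<in> fourier ` schwartz" for g i
  proof -
    have "\<exists>C. \<forall>x. \<bar>x\<bar> ^ i * norm (fourier f x) \<le> C" if "f \<in> schwartz" for f
      using that
    proof (induction i arbitrary: f)
      case 0
      show ?case using norm_fourier_le[of f] by auto
    next
      case (Suc i)
      show ?case
        using Suc.IH[OF schwartz_vderiv[OF Suc.prems]] Suc.prems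
        by (simp add: fourier_vderiv norm_mult algebra_simps)
    qed
    with that show ?thesis by blast
  qed
qed (use assms in auto)

text \<open>Fubini for cis(-\<xi> x) f(x) g(\<xi>), whose modulus is the integrable product |f(x)|
  |g(\<xi>)|. In the inversion formula it moves one transform from \<open>f\<close> to the
  Gaussian.\<close>

lemma fourier_multiplication_formula:
  assumes f[measurable]: "integrable lborel f" and g[measurable]: "integrable lborel g"
  shows "(LINT \<xi>|lborel. fourier f \<xi> * g \<xi>) = (LINT x|lborel. f x * fourier g x)"
proof -
  let ?k = "\<lambda>\<xi> x. cis (- (\<xi> * x)) * f x * g \<xi>"
  have "integrable (lborel \<Otimes>\<^sub>M lborel) (case_prod ?k)"
  proof (rule lborel_pair.Fubini_integrable)
    show "integrable lborel (\<lambda>\<xi>. LINT x|lborel. norm (case (\<xi>, x) of (\<xi>, x) \<Rightarrow> ?k \<xi> x))"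
      using g by (simp add: norm_mult)
    show "AE \<xi> in lborel. integrable lborel (\<lambda>x. case (\<xi>, x) of (\<xi>, x) \<Rightarrow> ?k \<xi> x)"
      using integrable_cis_mult[OF f] by simp
  qed measurable
  from lborel_pair.Fubini_integral[OF this]
  have "(LINT x|lborel. LINT \<xi>|lborel. ?k \<xi> x) = (LINT \<xi>|lborel. LINT x|lborel. ?k \<xi> x)" .
  moreover have "(LINT x|lborel. ?k \<xi> x) = fourier f \<xi> * g \<xi>" for \<xi>
    unfolding fourier_def by simp
  moreover have "(LINT \<xi>|lborel. ?k \<xi> x) = f x * fourier g x" for x
  proof -
    have "?k \<xi> x = f x * (cis (- (x * \<xi>)) * g \<xi>)" for \<xi> by (simp add: mult_ac)
    then show ?thesis unfolding fourier_def by (simp only: integral_mult_right_zero)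
  qed
  ultimately show ?thesis by (simp only:)
qed

section \<open>Gaussians and the inversion formula\<close>

lemma gaussian_integrable: "integrable lborel (\<lambda>x::real. exp (- x\<^sup>2 / 2))"
proof -
  have "integrable lborel (\<lambda>x. sqrt (2 * pi) * std_normal_density x)" by simp
  then show ?thesis by (simp add: std_normal_density_def)
qed

text \<open>Read off from the characteristic function of the standard normal distribution, after
  removing the normalization 1 / sqrt(2 pi).\<close>

lemma gaussian_integral:
  "(LINT x|lborel. cis (t * x) * complex_of_real (exp (- x\<^sup>2 / 2))) = sqrt (2 * pi) * exp (- t\<^sup>2 / 2)"
proof -
  have "complex_of_real (exp (- t\<^sup>2 / 2)) = char std_normal_distribution t"
    by (simp only: char_std_normal_distribution)
  also have "\<dots> = (LINT x|lborel. std_normal_density x *\<^sub>R iexp (t * x))"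
    unfolding char_def by (subst integral_density) (auto intro!: measurable_compose[OF _ borel_measurable_continuous_onI] continuous_intros)
  also have "\<dots> = (LINT x|lborel. complex_of_real (1 / sqrt (2 * pi)) * (cis (t * x) * complex_of_real (exp (- x\<^sup>2 / 2))))"
    by (rule Bochner_Integration.integral_cong) (simp_all add: std_normal_density_def scaleR_conv_of_real cis_conv_exp mult_ac)
  also have "\<dots> = complex_of_real (1 / sqrt (2 * pi)) * (LINT x|lborel. cis (t * x) * complex_of_real (exp (- x\<^sup>2 / 2)))"
    by (rule integral_mult_right_zero)
  finally show ?thesis by (simp add: field_simps)
qed

text \<open>The modulation adds x to the frequency y; hence the resulting Gaussian, as a function of
  y, is centred at -x. The substitution \<xi> = \<eta> / \<epsilon> reduces the integral to the
  standard Gaussian.\<close>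

lemma fourier_modulated_gaussian:
  assumes "\<epsilon> > 0"
  shows "fourier (\<lambda>\<xi>. cis (- (x * \<xi>)) * complex_of_real (exp (- (\<epsilon> * \<xi>)\<^sup>2 / 2))) y =
    complex_of_real (sqrt (2 * pi) / \<epsilon> * exp (- ((x + y) / \<epsilon>)\<^sup>2 / 2))"
proof -
  have "fourier (\<lambda>\<xi>. cis (- (x * \<xi>)) * complex_of_real (exp (- (\<epsilon> * \<xi>)\<^sup>2 / 2))) y =
     \<bar>1 / \<epsilon>\<bar> *\<^sub>R (LINT \<eta>|lborel. cis (- (y * (0 + 1 / \<epsilon> * \<eta>))) * (cis (- (x * (0 + 1 / \<epsilon> * \<eta>))) * complex_of_real (exp (- (\<epsilon> * (0 + 1 / \<epsilon> * \<eta>))\<^sup>2 / 2))))"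
    unfolding fourier_def by (rule lborel_integral_real_affine) (use assms in simp)
  also have "\<dots> = \<bar>1 / \<epsilon>\<bar> *\<^sub>R (LINT \<eta>|lborel. cis (- ((x + y) / \<epsilon>) * \<eta>) * complex_of_real (exp (- \<eta>\<^sup>2 / 2)))"
    using assms by (simp add: cis_mult algebra_simps add_divide_distrib flip: mult.assoc)
  also have "\<dots> = complex_of_real (sqrt (2 * pi) / \<epsilon> * exp (- ((x + y) / \<epsilon>)\<^sup>2 / 2))"
    unfolding gaussian_integral using assms by (simp add: scaleR_conv_of_real)
  finally show ?thesis .
qed

lemma fourier_fourier:
  fixes f :: "real \<Rightarrow> complex"
  assumes f: "f \<in> schwartz"
  shows "fourier (fourier f) x = 2 * pi * f (- x)"
proof -
  \<comment> \<open>The double transform is regularized by a Gaussian factor of width \<open>1 / \<epsilon> n\<close>; by the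
    multiplication formula it becomes the average of \<open>f\<close> against a Gaussian of width \<open>\<epsilon> n\<close> at \<open>- x\<close>.\<close>
  define \<epsilon> where "\<epsilon> n = 1 / real (Suc n)" for n
  have \<epsilon>: "\<epsilon> n > 0" for n by (simp add: \<epsilon>_def)
  have \<epsilon>0: "\<epsilon> \<longlonglongrightarrow> 0" unfolding \<epsilon>_def by (rule LIMSEQ_Suc[OF lim_1_over_n])
  let ?G = "\<lambda>n \<xi>. cis (- (x * \<xi>)) * complex_of_real (exp (- (\<epsilon> n * \<xi>)\<^sup>2 / 2))"
  have "integrable lborel (\<lambda>\<xi>. exp (- (0 + \<epsilon> n * \<xi>)\<^sup>2 / 2))" for n
    using \<epsilon>[of n] by (intro lborel_integrable_real_affine[OF gaussian_integrable]) auto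
  then have G: "integrable lborel (?G n)" for n
    by (intro integrable_cis_mult integrable_of_real) simp
  have eq: "(LINT \<xi>|lborel. fourier f \<xi> * ?G n \<xi>) =
      (LINT z|lborel. f (- x + \<epsilon> n * z) * complex_of_real (sqrt (2 * pi) * exp (- z\<^sup>2 / 2)))" for n
  proof -
    have "(LINT \<xi>|lborel. fourier f \<xi> * ?G n \<xi>) =
        (LINT y|lborel. f y * complex_of_real (sqrt (2 * pi) / \<epsilon> n * exp (- ((x + y) / \<epsilon> n)\<^sup>2 / 2)))"
      by (subst fourier_multiplication_formula[OF schwartz_integrable[OF f] G]) (simp only: fourier_modulated_gaussian[OF \<epsilon>])
    also have "\<dots> = \<bar>\<epsilon> n\<bar> *\<^sub>R (LINT z|lborel. f (- x + \<epsilon> n * z) *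
        complex_of_real (sqrt (2 * pi) / \<epsilon> n * exp (- ((x + (- x + \<epsilon> n * z)) / \<epsilon> n)\<^sup>2 / 2)))"
      by (rule lborel_integral_real_affine) (use \<epsilon>[of n] in simp)
    also have "\<dots> = (LINT z|lborel. \<bar>\<epsilon> n\<bar> *\<^sub>R (f (- x + \<epsilon> n * z) *
        complex_of_real (sqrt (2 * pi) / \<epsilon> n * exp (- ((x + (- x + \<epsilon> n * z)) / \<epsilon> n)\<^sup>2 / 2))))"
      by (rule integral_scaleR_right[symmetric])
    also have "\<dots> = (LINT z|lborel. f (- x + \<epsilon> n * z) * complex_of_real (sqrt (2 * pi) * exp (- z\<^sup>2 / 2)))"
      using \<epsilon>[of n] by (intro Bochner_Integration.integral_cong refl) (simp add: scaleR_conv_of_real)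
    finally show ?thesis .
  qed
  have m: "fourier f \<in> borel_measurable borel" "f \<in> borel_measurable borel"
    by (simp_all add: schwartz_measurable fourier_schwartz f)
  \<comment> \<open>The Gaussian factor is at most 1 and tends to 1 pointwise, so the integrable
    transform of \<open>f\<close> dominates.\<close>
  have lim1: "(\<lambda>n. LINT \<xi>|lborel. fourier f \<xi> * ?G n \<xi>) \<longlonglongrightarrow> (LINT \<xi>|lborel. fourier f \<xi> * cis (- (x * \<xi>)))"
  proof (rule integral_dominated_convergence[where w = "\<lambda>\<xi>. norm (fourier f \<xi>)"])
    show "AE \<xi> in lborel. (\<lambda>n. fourier f \<xi> * ?G n \<xi>) \<longlonglongrightarrow> fourier f \<xi> * cis (- (x * \<xi>))"
    proof (rule AE_I2)
      fix \<xi>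
      have "(\<lambda>n. fourier f \<xi> * ?G n \<xi>) \<longlonglongrightarrow> fourier f \<xi> * (cis (- (x * \<xi>)) * complex_of_real (exp (- (0 * \<xi>)\<^sup>2 / 2)))"
        by (intro tendsto_intros \<epsilon>0) auto
      then show "(\<lambda>n. fourier f \<xi> * ?G n \<xi>) \<longlonglongrightarrow> fourier f \<xi> * cis (- (x * \<xi>))" by simp
    qed
    show "integrable lborel (\<lambda>\<xi>. norm (fourier f \<xi>))"
      by (intro integrable_norm schwartz_integrable fourier_schwartz f)
  qed (use m in \<open>auto simp: norm_mult mult_left_le\<close>)
  have eq1: "(LINT \<xi>|lborel. fourier f \<xi> * cis (- (x * \<xi>))) = fourier (fourier f) x"
    unfolding fourier_def[of "fourier f"] by (simp add: mult.commute)
  obtain C where C: "\<And>x. norm (f x) \<le> C"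
    using schwartz_bound[OF f, of 0] by auto
  have lim2: "(\<lambda>n. LINT z|lborel. f (- x + \<epsilon> n * z) * complex_of_real (sqrt (2 * pi) * exp (- z\<^sup>2 / 2))) \<longlonglongrightarrow>
      (LINT z|lborel. f (- x) * complex_of_real (sqrt (2 * pi) * exp (- z\<^sup>2 / 2)))"
  proof (rule integral_dominated_convergence[where w = "\<lambda>z. C * (sqrt (2 * pi) * exp (- z\<^sup>2 / 2))"])
    show "AE z in lborel. (\<lambda>n. f (- x + \<epsilon> n * z) * complex_of_real (sqrt (2 * pi) * exp (- z\<^sup>2 / 2))) \<longlonglongrightarrow>
       f (- x) * complex_of_real (sqrt (2 * pi) * exp (- z\<^sup>2 / 2))"
    proof (rule AE_I2)
      fix z
      have "isCont f (- x + 0 * z)"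
        using schwartz_continuous[OF f, of UNIV] continuous_on_eq_continuous_at by blast
      then have "(\<lambda>n. f (- x + \<epsilon> n * z)) \<longlonglongrightarrow> f (- x + 0 * z)"
        by (rule isCont_tendsto_compose) (intro tendsto_intros \<epsilon>0)
      then show "(\<lambda>n. f (- x + \<epsilon> n * z) * complex_of_real (sqrt (2 * pi) * exp (- z\<^sup>2 / 2))) \<longlonglongrightarrow>
       f (- x) * complex_of_real (sqrt (2 * pi) * exp (- z\<^sup>2 / 2))"
        by (intro tendsto_mult_right) simp
    qed
    show "integrable lborel (\<lambda>z. C * (sqrt (2 * pi) * exp (- z\<^sup>2 / 2)))"
      by (intro integrable_mult_right gaussian_integrable)
    show "AE z in lborel. norm (f (- x + \<epsilon> n * z) * complex_of_real (sqrt (2 * pi) * exp (- z\<^sup>2 / 2))) \<le> C * (sqrt (2 * pi) * exp (- z\<^sup>2 / 2))" for n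
      using C by (auto simp: norm_mult intro!: mult_right_mono)
  qed (use m in measurable)
  \<comment> \<open>One factor sqrt(2 pi) comes from the transform of the Gaussian, the other from
    its integral.\<close>
  have eq2: "(LINT z|lborel. f (- x) * complex_of_real (sqrt (2 * pi) * exp (- z\<^sup>2 / 2))) = 2 * pi * f (- x)"
  proof -
    have "(LINT z|lborel. complex_of_real (exp (- z\<^sup>2 / 2))) = sqrt (2 * pi)"
      using gaussian_integral[of 0] by (simp del: integral_complex_of_real)
    then have "(LINT z|lborel. f (- x) * (complex_of_real (sqrt (2 * pi)) * complex_of_real (exp (- z\<^sup>2 / 2)))) =
        f (- x) * (complex_of_real (sqrt (2 * pi)) * complex_of_real (sqrt (2 * pi)))"
      by (simp del: integral_complex_of_real)
    then show ?thesis
      by (simp flip: of_real_mult)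
  qed
  show ?thesis
    using LIMSEQ_unique[OF lim1[unfolded eq eq1] lim2[unfolded eq2]] .
qed


section \<open>Cut-offs and density of the compactly supported functions\<close>

lemma power_le_exp: "\<exists>C. \<forall>y\<ge>0. y ^ n \<le> C * exp (y::real)"
proof (cases "n = 0")
  case False
  have "y ^ n \<le> real n ^ n * exp y" if "y \<ge> 0" for y :: real
  proof -
    \<comment> \<open>The n-th power of this inequality gives the constant n^n.\<close>
    have "y / real n \<le> exp (y / real n)"
      using exp_ge_add_one_self[of "y / real n"] by linarith
    then have "(y / real n) ^ n \<le> exp (y / real n) ^ n"
      using that by (intro power_mono) auto
    also have "\<dots> = exp y"
      using False by (simp flip: exp_of_nat_mult)
    finally show ?thesis
      using False by (simp add: power_divide field_simps)
  qed
  then show ?thesis by blast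
qed (auto intro!: exI[of _ 1])

text \<open>The extra power y^n makes the induction over coefficients work: splitting off the
  constant term of the polynomial leaves y times a shorter one, and that y joins the power.\<close>

lemma poly_le_exp: "\<exists>C. \<forall>y\<ge>0. \<bar>y ^ n * poly p y\<bar> \<le> C * exp (y::real)"
proof (induction p arbitrary: n)
  case 0
  show ?case by (intro exI[of _ 0]) simp
next
  case (pCons a p)
  obtain C where C: "\<And>y. y \<ge> 0 \<Longrightarrow> \<bar>y ^ Suc n * poly p y\<bar> \<le> C * exp y"
    using pCons.IH by blast
  obtain D where D: "\<And>y::real. y \<ge> 0 \<Longrightarrow> y ^ n \<le> D * exp y"
    using power_le_exp by blast
  have "\<bar>y ^ n * poly (pCons a p) y\<bar> \<le> (\<bar>a\<bar> * D + C) * exp y" if "y \<ge> 0" for y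
  proof -
    have "\<bar>y ^ n * poly (pCons a p) y\<bar> = \<bar>a * y ^ n + y ^ Suc n * poly p y\<bar>"
      by (simp add: algebra_simps)
    also have "\<dots> \<le> \<bar>a\<bar> * y ^ n + \<bar>y ^ Suc n * poly p y\<bar>"
      using that by (intro order_trans[OF abs_triangle_ineq]) (simp add: abs_mult)
    also have "\<dots> \<le> \<bar>a\<bar> * (D * exp y) + C * exp y"
      using C[OF that] D[OF that] by (intro add_mono mult_left_mono) auto
    finally show ?thesis by (simp add: algebra_simps)
  qed
  then show ?case by blast
qed

text \<open>All derivatives of the classical flat function exp(- 1 / x), extended by 0, have this
  form for some polynomial p. The family is closed under differentiation, which fits the coinductive
  criterion for smoothness.\<close>

definition flat_exp :: "real poly \<Rightarrow> real \<Rightarrow> real" where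
  "flat_exp p x = (if x > 0 then poly p (1 / x) * exp (- (1 / x)) else 0)"

text \<open>The factor \<open>monom 1 2\<close> is \<open>- (1 / x)'\<close> written in the variable \<open>1 / x\<close>.\<close>

lemma flat_exp_has_derivative:
  "(flat_exp p has_real_derivative flat_exp (monom 1 2 * (p - pderiv p)) x) (at x)"
proof (cases x "0 :: real" rule: linorder_cases)
  case less
  have "((\<lambda>_. 0) has_real_derivative 0) (at x)" by simp
  then have "(flat_exp p has_real_derivative 0) (at x)"
    by (rule has_field_derivative_transform_within_open[of _ _ _ "{..<0}"])
       (use less in \<open>auto simp: flat_exp_def\<close>)
  then show ?thesis using less by (simp add: flat_exp_def)
next
  case greater
  have "((\<lambda>x. poly p (1 / x)) has_real_derivative poly (pderiv p) (1 / x) * (- 1 / x\<^sup>2)) (at x)"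
    by (rule DERIV_chain2[OF poly_DERIV])
       (use greater in \<open>auto intro!: derivative_eq_intros simp: power2_eq_square field_simps\<close>)
  then have "((\<lambda>x. poly p (1 / x) * exp (- (1 / x))) has_real_derivative
      poly (monom 1 2 * (p - pderiv p)) (1 / x) * exp (- (1 / x))) (at x)"
    using greater
    by (auto intro!: derivative_eq_intros simp: poly_monom power2_eq_square field_simps)
  then have "(flat_exp p has_real_derivative poly (monom 1 2 * (p - pderiv p)) (1 / x) * exp (- (1 / x))) (at x)"
    by (rule has_field_derivative_transform_within_open[of _ _ _ "{0<..}"])
       (use greater in \<open>auto simp: flat_exp_def\<close>)
  then show ?thesis using greater by (simp add: flat_exp_def)
next
  case equal
  obtain C where C: "\<And>y. y \<ge> 0 \<Longrightarrow> \<bar>y ^ 2 * poly p y\<bar> \<le> C * exp y"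
    using poly_le_exp by blast
  have "C \<ge> 0" using order_trans[OF abs_ge_zero C[of 0]] by simp
  \<comment> \<open>This is the preceding exponential bound at y = 1 / h. The exponent 2 leaves a
    factor |h| in the difference quotient at 0, so the derivative there is 0.\<close>
  have le: "\<bar>flat_exp p h\<bar> \<le> C * h^2" for h
  proof (cases "h > 0")
    case True
    have "\<bar>poly p (1 / h)\<bar> / h^2 \<le> C * exp (1 / h)"
      using C[of "1 / h"] True by (simp add: abs_mult power_divide)
    then show ?thesis
      using True by (simp add: flat_exp_def abs_mult exp_minus field_simps)
  qed (use \<open>C \<ge> 0\<close> in \<open>simp add: flat_exp_def\<close>)
  have "((\<lambda>h. (flat_exp p (0 + h) - flat_exp p 0) / h) \<longlongrightarrow> 0) (at 0)"
  proof (rule Lim_null_comparison)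
    show "((\<lambda>h. C * \<bar>h\<bar>) \<longlongrightarrow> 0) (at 0)"
      by (intro tendsto_mult_right_zero tendsto_rabs_zero) simp
    show "\<forall>\<^sub>F h in at 0. norm ((flat_exp p (0 + h) - flat_exp p 0) / h) \<le> C * \<bar>h\<bar>"
      using eventually_at_ball'[of 1 "0::real" UNIV, simplified]
    proof eventually_elim
      case (elim h)
      then have "\<bar>flat_exp p h\<bar> \<le> C * \<bar>h\<bar> * \<bar>h\<bar>"
        using le[of h] by (simp add: power2_eq_square mult.assoc)
      then show ?case using elim by (simp add: flat_exp_def[of _ 0] divide_le_eq)
    qed
  qed
  then show ?thesis
    unfolding equal by (simp add: DERIV_def flat_exp_def[of _ 0])
qed

lemma smooth_flat_exp: "smooth (\<lambda>x. complex_of_real (flat_exp p x))"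
proof (rule deriv_closed_smooth)
  show "deriv_closed (range (\<lambda>p x. complex_of_real (flat_exp p x)))"
    unfolding deriv_closed_def
  proof safe
    fix p
    show "\<exists>f'\<in>range (\<lambda>p x. complex_of_real (flat_exp p x)).
      \<forall>x. ((\<lambda>x. complex_of_real (flat_exp p x)) has_vector_derivative f' x) (at x)"
      using has_vector_derivative_of_real[OF flat_exp_has_derivative]
      by (intro bexI) (rule allI, assumption, rule rangeI)
  qed
qed auto

text \<open>The witness is e(1 + x) e(1 - x) / e(1)^2 with e(x) = exp(- 1 / x) for x > 0 and 0
  otherwise: one of the factors vanishes as soon as |x| \<ge> 1.\<close>

lemma bump_exists:
  obtains r :: "real \<Rightarrow> real"
  where "smooth (\<lambda>x. complex_of_real (r x))" "\<And>x. r x \<ge> 0" "r 0 = 1" "\<And>x. \<bar>x\<bar> \<ge> 1 \<Longrightarrow> r x = 0"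
proof
  define e where "e = flat_exp 1"
  have e0: "e 1 > 0" by (simp add: e_def flat_exp_def)
  let ?r = "\<lambda>x. 1 / (e 1)\<^sup>2 * (e (1 * x + 1) * e (- 1 * x + 1))"
  have "smooth (\<lambda>x. complex_of_real (1 / (e 1)\<^sup>2) * (complex_of_real (e (1 * x + 1)) * complex_of_real (e (- 1 * x + 1))))"
    unfolding e_def by (intro smooth_cmult smooth_mult smooth_affine[OF smooth_flat_exp])
  then show "smooth (\<lambda>x. complex_of_real (?r x))" by simp
  show "?r x \<ge> 0" for x
    by (auto simp: e_def flat_exp_def)
  show "?r 0 = 1" using e0 by (simp add: power2_eq_square)
  show "?r x = 0" if "\<bar>x\<bar> \<ge> 1" for x
    using that by (auto simp: e_def flat_exp_def)
qed

section \<open>Compactly supported smooth functions\<close>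

lemma compactly_supported_vderiv:
  assumes "smooth f" "compactly_supported f"
  shows "compactly_supported (vderiv f)"
proof -
  obtain R where R: "\<And>x. \<bar>x\<bar> > R \<Longrightarrow> f x = 0"
    using assms unfolding compactly_supported_def by blast
  have "vderiv f x = 0" if x: "\<bar>x\<bar> > R" for x
  proof -
    have "((\<lambda>_. 0) has_vector_derivative vderiv f x) (at x)"
    proof (rule has_vector_derivative_transform_within_open[OF smoothD[OF assms(1)]])
      show "open {y. \<bar>y\<bar> > R}"
        by (intro open_Collect_less continuous_intros)
    qed (use x R in auto)
    then show ?thesis
      using vector_derivative_unique_at has_vector_derivative_const by blast
  qed
  then show ?thesis unfolding compactly_supported_def by blast
qed

lemma compactly_supported_schwartz:
  assumes "smooth f" "compactly_supported f"
  shows "f \<in> schwartz"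
proof (rule schwartzI)
  let ?A = "{f. smooth f \<and> compactly_supported f}"
  show "deriv_closed ?A"
    unfolding deriv_closed_def
    by (auto intro!: exI[of _ "vderiv _"] smooth_vderiv compactly_supported_vderiv smoothD)
  show "f \<in> ?A" using assms by simp
  fix f i assume f: "f \<in> ?A"
  obtain R where R: "\<And>x. \<bar>x\<bar> > R \<Longrightarrow> f x = 0"
    using f unfolding compactly_supported_def by blast
  have "compact ((\<lambda>x. \<bar>x\<bar> ^ i * norm (f x)) ` {- R..R})"
    using f by (intro compact_continuous_image continuous_intros smooth_continuous) auto
  from compact_imp_bounded[OF this]
  obtain C where C: "\<And>x. x \<in> {-R..R} \<Longrightarrow> \<bar>x\<bar> ^ i * norm (f x) \<le> C"
    unfolding bounded_iff by fastforce
  have "\<bar>x\<bar> ^ i * norm (f x) \<le> max C 0" for x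
  proof (cases "\<bar>x\<bar> > R")
    case False
    then have "x \<in> {- R..R}" by auto
    then show ?thesis by (intro max.coboundedI1 C)
  qed (simp add: R)
  then show "\<exists>C. \<forall>x. \<bar>x\<bar> ^ i * norm (f x) \<le> C" by blast
qed

section \<open>Products f(x) g(s x) with a small scale s\<close>

lemma smooth_scale: "smooth f \<Longrightarrow> smooth (\<lambda>x. f (s * x))"
  using smooth_affine[of f s 0] by simp

lemma vderiv_scale: "smooth f \<Longrightarrow> vderiv (\<lambda>x. f (s * x)) = (\<lambda>x. complex_of_real s * vderiv f (s * x))"
  using vderiv_affine[of f s 0] by simp

text \<open>The recursion behind both estimates below. The term that differentiates g carries a
  factor s; the other one passes the derivative on to f.\<close>

lemma vderiv_iter_Suc_mult_scale:
  assumes "smooth f" "smooth g"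
  shows "vderiv_iter (Suc j) (\<lambda>x. f x * g (s * x)) x =
    complex_of_real s * vderiv_iter j (\<lambda>x. f x * vderiv g (s * x)) x + vderiv_iter j (\<lambda>x. vderiv f x * g (s * x)) x"
proof -
  have "vderiv (\<lambda>x. f x * g (s * x)) =
      (\<lambda>x. complex_of_real s * (f x * vderiv g (s * x)) + vderiv f x * g (s * x))"
    unfolding vderiv_mult[OF assms(1) smooth_scale[OF assms(2)]] vderiv_scale[OF assms(2)]
    by (simp add: mult.left_commute)
  then show ?thesis
    using assms by (simp add: vderiv_iter_Suc vderiv_iter_add vderiv_iter_cmult smooth_cmult smooth_mult smooth_scale smooth_vderiv)
qed

text \<open>What matters is that the constant does not depend on s. The induction varies both f and
  g, since either may receive the derivative.\<close>

lemma schwartz_mult_scale_bound: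
  assumes "f \<in> schwartz" "smooth g" "\<And>k. bounded (range (vderiv_iter k g))"
  shows "\<exists>C. \<forall>s\<in>{0..1}. \<forall>x. \<bar>x\<bar> ^ i * norm (vderiv_iter j (\<lambda>x. f x * g (s * x)) x) \<le> C"
  using assms
proof (induction j arbitrary: f g)
  case 0
  obtain C where C: "\<And>x. \<bar>x\<bar> ^ i * norm (f x) \<le> C"
    using schwartz_bound 0 by blast
  obtain D where D: "\<And>x. norm (g x) \<le> D"
    using 0(3)[of 0] by (auto simp: bounded_iff)
  have "D \<ge> 0" using order_trans[OF norm_ge_zero D] .
  have "C \<ge> 0" by (rule order_trans[OF _ C[of 0]]) simp
  then have "\<bar>x\<bar> ^ i * norm (f x) * norm (g (s * x)) \<le> C * D" for s x
    by (intro mult_mono C D) auto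
  then show ?case by (auto simp: norm_mult mult.assoc intro!: exI[of _ "C * D"])
next
  case (Suc j)
  obtain C where C: "\<And>s x. s \<in> {0..1} \<Longrightarrow> \<bar>x\<bar> ^ i * norm (vderiv_iter j (\<lambda>x. f x * vderiv g (s * x)) x) \<le> C"
    using Suc.IH[OF Suc.prems(1) smooth_vderiv[OF Suc.prems(2)]] Suc.prems(3)
    unfolding vderiv_iter_Suc[symmetric] by blast
  obtain D where D: "\<And>s x. s \<in> {0..1} \<Longrightarrow> \<bar>x\<bar> ^ i * norm (vderiv_iter j (\<lambda>x. vderiv f x * g (s * x)) x) \<le> D"
    using Suc.IH[OF schwartz_vderiv[OF Suc.prems(1)] Suc.prems(2,3)] by blast
  have "\<bar>x\<bar> ^ i * norm (vderiv_iter (Suc j) (\<lambda>x. f x * g (s * x)) x) \<le> C + D" if s: "s \<in> {0..1}" for s x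
  proof -
    have "norm (complex_of_real s * z + w) \<le> norm z + norm w" for z w
      using s by (intro order_trans[OF norm_triangle_ineq]) (simp add: norm_mult mult_left_le_one_le)
    then have "\<bar>x\<bar> ^ i * norm (vderiv_iter (Suc j) (\<lambda>x. f x * g (s * x)) x) \<le>
        \<bar>x\<bar> ^ i * (norm (vderiv_iter j (\<lambda>x. f x * vderiv g (s * x)) x) + norm (vderiv_iter j (\<lambda>x. vderiv f x * g (s * x)) x))"
      using vderiv_iter_Suc_mult_scale[OF schwartz_smooth[OF Suc.prems(1)] Suc.prems(2)]
      by (intro mult_left_mono) auto
    also have "\<dots> \<le> C + D"
      unfolding distrib_left by (intro add_mono C D s)
    finally show ?thesis .
  qed
  then show ?case by blast
qed

text \<open>The gain of a factor s has two sources. If g is not differentiated, then g(0) = 0 gives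
  |g(s x)| \<le> D s |x|, and the decay of f absorbs |x|. If g is differentiated, the chain rule
  supplies s and the uniform bound above suffices; g' need not vanish at 0, so here g stays fixed in
  the induction.\<close>

lemma schwartz_mult_scale_small:
  assumes "f \<in> schwartz" "smooth g" "\<And>k. bounded (range (vderiv_iter k g))" "g 0 = 0"
  shows "\<exists>C. \<forall>s\<in>{0..1}. \<forall>x. \<bar>x\<bar> ^ i * norm (vderiv_iter j (\<lambda>x. f x * g (s * x)) x) \<le> C * s"
  using assms(1)
proof (induction j arbitrary: f)
  case 0
  obtain C where C: "\<And>x. \<bar>x\<bar> ^ Suc i * norm (f x) \<le> C"
    using schwartz_bound 0 by blast
  obtain D where D: "\<And>x. norm (vderiv g x) \<le> D"
    using assms(3)[of 1] by (auto simp: bounded_iff vderiv_iter_Suc)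
  have "D \<ge> 0" using order_trans[OF norm_ge_zero D] .
  have g: "norm (g y) \<le> D * \<bar>y\<bar>" for y
  proof -
    have "norm (g y - g 0) \<le> D * norm (y - 0)"
    proof (rule differentiable_bound)
      show "(g has_derivative (\<lambda>h. h *\<^sub>R vderiv g x)) (at x within UNIV)" for x
        using smoothD[OF assms(2)] by (simp add: has_vector_derivative_def)
      show "onorm (\<lambda>h. h *\<^sub>R vderiv g x) \<le> D" for x
        using D[of x] \<open>D \<ge> 0\<close> by (intro onorm_bound) (auto simp: mult.commute[of D] intro: mult_left_mono)
    qed auto
    then show ?thesis by (simp add: assms(4))
  qed
  have "\<bar>x\<bar> ^ i * norm (f x * g (s * x)) \<le> D * C * s" if "s \<in> {0..1}" for s x
  proof -
    have "\<bar>x\<bar> ^ i * norm (f x * g (s * x)) \<le> \<bar>x\<bar> ^ i * (norm (f x) * (D * \<bar>s * x\<bar>))"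
      unfolding norm_mult by (intro mult_left_mono g) auto
    also have "\<dots> = D * s * (\<bar>x\<bar> ^ Suc i * norm (f x))"
      using that by (simp add: abs_mult mult_ac)
    also have "\<dots> \<le> D * s * C"
      using that \<open>D \<ge> 0\<close> by (intro mult_left_mono C) auto
    finally show ?thesis by (simp add: mult_ac)
  qed
  then show ?case by (intro exI[of _ "D * C"]) simp
next
  case (Suc j)
  have "\<And>k. bounded (range (vderiv_iter k (vderiv g)))"
    using assms(3) by (simp flip: vderiv_iter_Suc)
  then obtain C where C: "\<And>s x. s \<in> {0..1} \<Longrightarrow> \<bar>x\<bar> ^ i * norm (vderiv_iter j (\<lambda>x. f x * vderiv g (s * x)) x) \<le> C"
    using schwartz_mult_scale_bound[OF Suc.prems smooth_vderiv[OF assms(2)]] by blast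
  obtain D where D: "\<And>s x. s \<in> {0..1} \<Longrightarrow> \<bar>x\<bar> ^ i * norm (vderiv_iter j (\<lambda>x. vderiv f x * g (s * x)) x) \<le> D * s"
    using Suc.IH[OF schwartz_vderiv[OF Suc.prems]] by blast
  have "\<bar>x\<bar> ^ i * norm (vderiv_iter (Suc j) (\<lambda>x. f x * g (s * x)) x) \<le> (C + D) * s" if s: "s \<in> {0..1}" for s x
  proof -
    have "norm (complex_of_real s * z + w) \<le> s * norm z + norm w" for z w
      using s by (intro order_trans[OF norm_triangle_ineq]) (simp add: norm_mult)
    then have "\<bar>x\<bar> ^ i * norm (vderiv_iter (Suc j) (\<lambda>x. f x * g (s * x)) x) \<le>
        \<bar>x\<bar> ^ i * (s * norm (vderiv_iter j (\<lambda>x. f x * vderiv g (s * x)) x) + norm (vderiv_iter j (\<lambda>x. vderiv f x * g (s * x)) x))"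
      using vderiv_iter_Suc_mult_scale[OF schwartz_smooth[OF Suc.prems(1)] assms(2)]
      by (intro mult_left_mono) auto
    also have "\<dots> = s * (\<bar>x\<bar> ^ i * norm (vderiv_iter j (\<lambda>x. f x * vderiv g (s * x)) x))
        + \<bar>x\<bar> ^ i * norm (vderiv_iter j (\<lambda>x. vderiv f x * g (s * x)) x)"
      by (simp add: algebra_simps)
    also have "\<dots> \<le> s * C + D * s"
      using s by (intro add_mono mult_left_mono C D s) auto
    finally show ?thesis by (simp add: algebra_simps)
  qed
  then show ?case by blast
qed

section \<open>Schwartz norms and density\<close>

lemma schwartz_norm_le:
  assumes "\<And>i j x. i \<le> N \<Longrightarrow> j \<le> N \<Longrightarrow> \<bar>x\<bar> ^ i * norm (vderiv_iter j f x) \<le> B i j"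
  shows "schwartz_norm N f \<le> (\<Sum>i\<le>N. \<Sum>j\<le>N. B i j)"
  unfolding schwartz_norm_def
  using assms by (intro sum_mono cSUP_least) (auto simp: power_abs)

lemma le_schwartz_norm:
  assumes "f \<in> schwartz" "i \<le> N" "j \<le> N"
  shows "\<bar>x\<bar> ^ i * norm (vderiv_iter j f x) \<le> schwartz_norm N f"
proof -
  have bdd: "bdd_above (range (\<lambda>x. norm (x ^ i *\<^sub>R vderiv_iter j f x)))" for i j
    using assms(1) unfolding schwartz_iff by (auto simp: power_abs bdd_above_def)
  have pos: "0 \<le> (SUP x. norm (x ^ i *\<^sub>R vderiv_iter j f x))" for i j
    by (rule order_trans[OF norm_ge_zero cSUP_upper[OF UNIV_I bdd]])
  have "\<bar>x\<bar> ^ i * norm (vderiv_iter j f x) \<le> (SUP x. norm (x ^ i *\<^sub>R vderiv_iter j f x))"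
    using cSUP_upper[OF UNIV_I bdd[of i j], of x] by (simp add: power_abs)
  also have "\<dots> \<le> (\<Sum>j\<le>N. SUP x. norm (x ^ i *\<^sub>R vderiv_iter j f x))"
    using assms(3) pos by (intro member_le_sum) auto
  also have "\<dots> \<le> schwartz_norm N f"
    unfolding schwartz_norm_def using assms(2) pos
    by (intro member_le_sum[of i _ "\<lambda>i. \<Sum>j\<le>N. SUP x. norm (x ^ i *\<^sub>R vderiv_iter j f x)"]) (auto intro: sum_nonneg)
  finally show ?thesis .
qed

lemma schwartz_norm_nonneg: "f \<in> schwartz \<Longrightarrow> schwartz_norm N f \<ge> 0"
  using le_schwartz_norm[of f 0 N 0 0] by (auto intro: order_trans[OF norm_ge_zero])

lemma tempered_bound:
  assumes "tempered U"
  obtains C N where "C \<ge> 0" "\<And>f. f \<in> schwartz \<Longrightarrow> norm (U f) \<le> C * schwartz_norm N f"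
proof -
  obtain C N where C: "\<And>f. f \<in> schwartz \<Longrightarrow> norm (U f) \<le> C * schwartz_norm N f"
    using assms unfolding tempered_def by blast
  show thesis
  proof
    show "norm (U f) \<le> \<bar>C\<bar> * schwartz_norm N f" if "f \<in> schwartz" for f
      using C[OF that] mult_right_mono[OF abs_ge_self[of C] schwartz_norm_nonneg[OF that, of N]] by linarith
  qed auto
qed

lemma tempered_linear:
  "tempered U \<Longrightarrow> f \<in> schwartz \<Longrightarrow> g \<in> schwartz \<Longrightarrow> U (\<lambda>x. c * f x + g x) = c * U f + U g"
  by (simp add: tempered_def)

lemma tempered_add_arg:
  "tempered U \<Longrightarrow> f \<in> schwartz \<Longrightarrow> g \<in> schwartz \<Longrightarrow> U (\<lambda>x. f x + g x) = U f + U g"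
  using tempered_linear[of U f g 1] by simp

text \<open>With a bump \<rho> and g = 1 - \<rho>, the function f splits into f(x) \<rho>(s x),
  which V annihilates, and f(x) g(s x), whose Schwartz norms are O(s) because g(0) = 0. Hence |V f|
  \<le> D s for every s in (0, 1].\<close>

lemma tempered_eq_0:
  assumes V: "tempered V"
    and 0: "\<And>f. f \<in> schwartz \<Longrightarrow> compactly_supported f \<Longrightarrow> V f = 0"
    and f: "f \<in> schwartz"
  shows "V f = 0"
proof -
  obtain r :: "real \<Rightarrow> real" where r: "smooth (\<lambda>x. complex_of_real (r x))" "r 0 = 1"
      "\<And>x. \<bar>x\<bar> \<ge> 1 \<Longrightarrow> r x = 0"
    using bump_exists by metis
  define \<rho> where "\<rho> x = complex_of_real (r x)" for x
  define g where "g x = 1 + - 1 * \<rho> x" for x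
  have \<rho>: "smooth \<rho>" "compactly_supported \<rho>"
    using r by (auto simp: \<rho>_def[abs_def] compactly_supported_def intro!: exI[of _ 1])
  have one: "smooth (\<lambda>_. 1)" using moderate_const moderate_def by blast
  have g: "smooth g"
    unfolding g_def by (intro smooth_add smooth_cmult one \<rho>)
  have vg: "vderiv g = (\<lambda>x. - 1 * vderiv \<rho> x)"
    unfolding g_def[abs_def] vderiv_add[OF one smooth_cmult[OF \<rho>(1)]] vderiv_cmult[OF \<rho>(1)]
    by (simp add: vderivI[OF has_vector_derivative_const])
  have \<rho>b: "bounded (range (vderiv_iter k \<rho>))" for k
    using le_schwartz_norm[OF compactly_supported_schwartz[OF \<rho>], of 0 k k] by (auto simp: bounded_iff)
  have gb: "bounded (range (vderiv_iter k g))" for k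
  proof (cases k)
    case 0
    obtain C where "\<And>x. norm (\<rho> x) \<le> C"
      using \<rho>b[of 0] by (auto simp: bounded_iff)
    then have "norm (g x) \<le> 1 + C" for x
      unfolding g_def by (intro order_trans[OF norm_triangle_ineq]) simp
    then show ?thesis using 0 by (auto simp: bounded_iff)
  next
    case (Suc j)
    then show ?thesis
      using \<rho>b[of k] \<rho>(1) unfolding Suc vderiv_iter_Suc vg
      by (subst vderiv_iter_cmult) (auto simp: smooth_vderiv bounded_iff)
  qed
  have "g 0 = 0" by (simp add: g_def \<rho>_def r)
  obtain C N where C: "C \<ge> 0" "\<And>f. f \<in> schwartz \<Longrightarrow> norm (V f) \<le> C * schwartz_norm N f"
    using tempered_bound[OF V] by blast
  obtain B where B: "\<And>i j s x. s \<in> {0..1} \<Longrightarrow> \<bar>x\<bar> ^ i * norm (vderiv_iter j (\<lambda>x. f x * g (s * x)) x) \<le> B i j * s"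
    using schwartz_mult_scale_small[OF f g gb \<open>g 0 = 0\<close>] by metis
  define D where "D = C * (\<Sum>i\<le>N. \<Sum>j\<le>N. B i j)"
  have le: "norm (V f) \<le> D * s" if s: "0 < s" "s \<le> 1" for s
  proof -
    have cut: "(\<lambda>x. f x * \<rho> (s * x)) \<in> schwartz" "compactly_supported (\<lambda>x. f x * \<rho> (s * x))"
    proof -
      show "compactly_supported (\<lambda>x. f x * \<rho> (s * x))"
        unfolding compactly_supported_def
      proof (intro exI allI impI)
        fix x assume "\<bar>x\<bar> > 1 / s"
        then have "\<bar>s * x\<bar> \<ge> 1" using s by (simp add: abs_mult field_simps)
        then show "f x * \<rho> (s * x) = 0" by (simp add: \<rho>_def r(3))
      qed
      then show "(\<lambda>x. f x * \<rho> (s * x)) \<in> schwartz"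
        by (rule compactly_supported_schwartz[OF smooth_mult[OF schwartz_smooth[OF f] smooth_scale[OF \<rho>(1)]]])
    qed
    have rest: "(\<lambda>x. f x * g (s * x)) \<in> schwartz"
      using schwartz_add[OF f schwartz_cmult[OF cut(1), of "-1"]] by (simp add: g_def algebra_simps)
    have "V f = V (\<lambda>x. f x * g (s * x) + f x * \<rho> (s * x))"
      by (simp add: g_def algebra_simps)
    also have "\<dots> = V (\<lambda>x. f x * g (s * x))"
      using tempered_add_arg[OF V rest cut(1)] 0[OF cut] by simp
    finally have "norm (V f) \<le> C * schwartz_norm N (\<lambda>x. f x * g (s * x))"
      using C(2)[OF rest] by simp
    also have "\<dots> \<le> C * (\<Sum>i\<le>N. \<Sum>j\<le>N. B i j * s)"
      using B s C(1) by (intro mult_left_mono schwartz_norm_le) auto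
    finally show ?thesis by (simp add: D_def sum_distrib_right mult.assoc)
  qed
  have "norm (V f) \<le> 0"
  proof (rule field_le_epsilon)
    fix e :: real assume "e > 0"
    \<comment> \<open>The sign of D is not known and D may be 0; |D| + 1 is a positive upper
      bound.\<close>
    define s where "s = min 1 (e / (\<bar>D\<bar> + 1))"
    have s: "0 < s" "s \<le> 1" "s \<le> e / (\<bar>D\<bar> + 1)" using \<open>e > 0\<close> by (auto simp: s_def)
    have "norm (V f) \<le> (\<bar>D\<bar> + 1) * s"
      using le[OF s(1,2)] s(1) by (smt (verit, best) mult_right_mono)
    also have "\<dots> \<le> e"
      using s(3) by (simp add: field_simps)
    finally show "norm (V f) \<le> 0 + e" by simp
  qed
  then show ?thesis by simp
qed

section \<open>Tempered distributions under reflections, translations and sums\<close>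

lemma abs_power_affine_le:
  fixes x h s :: real
  assumes "\<bar>s\<bar> = 1"
  shows "\<bar>x\<bar> ^ i \<le> (1 + \<bar>h\<bar>) ^ i * (1 + \<bar>s * x + h\<bar> ^ i)"
proof -
  let ?y = "s * x + h"
  have "\<bar>x\<bar> = \<bar>?y - h\<bar>" by (simp add: abs_mult assms)
  also have "\<dots> \<le> \<bar>?y\<bar> + \<bar>h\<bar>" by (rule abs_triangle_ineq4)
  also have "\<dots> \<le> (1 + \<bar>h\<bar>) * max 1 \<bar>?y\<bar>"
    using mult_left_mono[OF max.cobounded1[of 1 "\<bar>?y\<bar>"] abs_ge_zero[of h]] max.cobounded2[of "\<bar>?y\<bar>" 1]
    unfolding distrib_right by linarith
  finally have "\<bar>x\<bar> ^ i \<le> ((1 + \<bar>h\<bar>) * max 1 \<bar>?y\<bar>) ^ i"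
    by (rule power_mono) simp
  also have "\<dots> \<le> (1 + \<bar>h\<bar>) ^ i * (1 + \<bar>?y\<bar> ^ i)"
    unfolding power_mult_distrib by (intro mult_left_mono) (auto simp: max_def)
  finally show ?thesis .
qed

text \<open>The weight |x|^i is compared with the weights 1 and |s x + h|^i at the shifted point;
  these two terms give the factor 2. The same order N occurs on both sides, so temperedness is
  preserved.\<close>

lemma schwartz_affine_bound:
  assumes f: "f \<in> schwartz" and s: "\<bar>s\<bar> = 1" and "i \<le> N" "j \<le> N"
  shows "\<bar>x\<bar> ^ i * norm (vderiv_iter j (\<lambda>x. f (s * x + h)) x) \<le> 2 * (1 + \<bar>h\<bar>) ^ N * schwartz_norm N f"
proof -
  let ?v = "norm (vderiv_iter j f (s * x + h))"
  have "\<bar>x\<bar> ^ i * norm (vderiv_iter j (\<lambda>x. f (s * x + h)) x) = \<bar>x\<bar> ^ i * ?v"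
    using s by (simp add: vderiv_iter_affine[OF schwartz_smooth[OF f]] norm_mult norm_power)
  also have "\<dots> \<le> (1 + \<bar>h\<bar>) ^ i * (1 + \<bar>s * x + h\<bar> ^ i) * ?v"
    by (intro mult_right_mono abs_power_affine_le s) auto
  also have "\<dots> = (1 + \<bar>h\<bar>) ^ i * (\<bar>s * x + h\<bar> ^ 0 * ?v + \<bar>s * x + h\<bar> ^ i * ?v)"
    by (simp add: algebra_simps)
  also have "\<dots> \<le> (1 + \<bar>h\<bar>) ^ N * (schwartz_norm N f + schwartz_norm N f)"
    using assms by (intro mult_mono add_mono le_schwartz_norm power_increasing) auto
  finally show ?thesis by simp
qed

lemma schwartz_affine:
  assumes "f \<in> schwartz" "\<bar>s\<bar> = 1"
  shows "(\<lambda>x. f (s * x + h)) \<in> schwartz"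
  unfolding schwartz_iff
proof (intro conjI allI)
  show "smooth (\<lambda>x. f (s * x + h))" by (rule smooth_affine[OF schwartz_smooth[OF assms(1)]])
  show "\<exists>C. \<forall>x. \<bar>x\<bar> ^ i * norm (vderiv_iter j (\<lambda>x. f (s * x + h)) x) \<le> C" for i j
    using schwartz_affine_bound[OF assms, of i "max i j" j] by auto
qed

lemma tempered_affine:
  assumes U: "tempered U" and s: "\<bar>s\<bar> = 1"
  shows "tempered (\<lambda>f. U (\<lambda>x. f (s * x + h)))"
proof -
  obtain C N where C: "C \<ge> 0" "\<And>f. f \<in> schwartz \<Longrightarrow> norm (U f) \<le> C * schwartz_norm N f"
    using tempered_bound[OF U] by blast
  have "norm (U (\<lambda>x. f (s * x + h))) \<le> (C * (\<Sum>i\<le>N. \<Sum>j\<le>N. 2 * (1 + \<bar>h\<bar>) ^ N)) * schwartz_norm N f"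
    if f: "f \<in> schwartz" for f
  proof -
    have "norm (U (\<lambda>x. f (s * x + h))) \<le> C * schwartz_norm N (\<lambda>x. f (s * x + h))"
      by (intro C schwartz_affine f s)
    also have "\<dots> \<le> C * (\<Sum>i\<le>N. \<Sum>j\<le>N. 2 * (1 + \<bar>h\<bar>) ^ N * schwartz_norm N f)"
      by (intro mult_left_mono schwartz_norm_le schwartz_affine_bound f s C)
    finally show ?thesis by (simp only: sum_distrib_right mult.assoc)
  qed
  moreover have "U (\<lambda>x. c * f (s * x + h) + g (s * x + h)) = c * U (\<lambda>x. f (s * x + h)) + U (\<lambda>x. g (s * x + h))"
    if "f \<in> schwartz" "g \<in> schwartz" for f g c
    by (intro tempered_linear U schwartz_affine s that)
  ultimately show ?thesis unfolding tempered_def by blast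
qed

lemma tempered_add:
  assumes U: "tempered U" and V: "tempered V"
  shows "tempered (\<lambda>f. U f + V f)"
proof -
  obtain C N where C: "C \<ge> 0" "\<And>f. f \<in> schwartz \<Longrightarrow> norm (U f) \<le> C * schwartz_norm N f"
    using tempered_bound[OF U] by blast
  obtain D M where D: "D \<ge> 0" "\<And>f. f \<in> schwartz \<Longrightarrow> norm (V f) \<le> D * schwartz_norm M f"
    using tempered_bound[OF V] by blast
  \<comment> \<open>The orders N and M may differ. Each weighted derivative in the norm of order n
    is bounded by the norm of order max N M, so counting the summands compares the two
    norms.\<close>
  have mono: "schwartz_norm n f \<le> (\<Sum>i\<le>n. \<Sum>j\<le>n. 1) * schwartz_norm (max N M) f"
    if f: "f \<in> schwartz" and "n \<le> max N M" for f n
  proof -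
    have "schwartz_norm n f \<le> (\<Sum>i\<le>n. \<Sum>j\<le>n. schwartz_norm (max N M) f)"
      by (intro schwartz_norm_le le_schwartz_norm f) (use that in auto)
    then show ?thesis by (simp add: sum_distrib_right)
  qed
  have "norm (U f + V f) \<le> (C * (\<Sum>i\<le>N. \<Sum>j\<le>N. 1) + D * (\<Sum>i\<le>M. \<Sum>j\<le>M. 1)) * schwartz_norm (max N M) f"
    if f: "f \<in> schwartz" for f
  proof -
    have "norm (U f + V f) \<le> C * schwartz_norm N f + D * schwartz_norm M f"
      by (intro order_trans[OF norm_triangle_ineq] add_mono C D f)
    also have "\<dots> \<le> C * ((\<Sum>i\<le>N. \<Sum>j\<le>N. 1) * schwartz_norm (max N M) f) + D * ((\<Sum>i\<le>M. \<Sum>j\<le>M. 1) * schwartz_norm (max N M) f)"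
      by (intro add_mono mult_left_mono mono f C D) auto
    finally show ?thesis by (simp only: distrib_right mult.assoc)
  qed
  moreover have "U (\<lambda>x. c * f x + g x) + V (\<lambda>x. c * f x + g x) = c * (U f + V f) + (U g + V g)"
    if "f \<in> schwartz" "g \<in> schwartz" for f g c
    using tempered_linear[OF U that] tempered_linear[OF V that] by (simp add: algebra_simps)
  ultimately show ?thesis unfolding tempered_def by blast
qed


section \<open>Affine changes of variable and uniqueness of the convolution\<close>

lemma integrable_compactly_supported:
  fixes h :: "real \<Rightarrow> 'a::{banach, second_countable_topology}"
  assumes "continuous_on UNIV h" "\<And>x. \<bar>x\<bar> > R \<Longrightarrow> h x = 0"
  shows "integrable lborel h"
proof -
  have "integrable lborel (\<lambda>x. indicator {-R..R} x *\<^sub>R h x)"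
    by (intro borel_integrable_compact continuous_on_subset[OF assms(1)]) auto
  moreover have "indicator {-R..R} x *\<^sub>R h x = h x" for x
    using assms(2)[of x] by (cases "\<bar>x\<bar> > R") (auto simp: indicator_def abs_le_iff)
  ultimately show ?thesis by simp
qed

text \<open>Continuity makes each function integrable against compactly supported test functions,
  which is what allows the integral of the sum to be split.\<close>

lemma represents_add:
  assumes U: "represents U f" and V: "represents V g"
    and f: "continuous_on UNIV f" and g: "continuous_on UNIV g"
  shows "represents (\<lambda>\<phi>. U \<phi> + V \<phi>) (\<lambda>x. f x + g x)"
  unfolding represents_def
proof (intro conjI ballI impI)
  show "tempered (\<lambda>\<phi>. U \<phi> + V \<phi>)"
    using U V by (intro tempered_add) (auto simp: represents_def)
  fix \<phi> assume \<phi>: "\<phi> \<in> schwartz" "compactly_supported \<phi>"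
  obtain R where R: "\<And>x. \<bar>x\<bar> > R \<Longrightarrow> \<phi> x = 0"
    using \<phi>(2) unfolding compactly_supported_def by blast
  have "integrable lborel (\<lambda>x. complex_of_real (h x) * \<phi> x)" if "continuous_on UNIV h" for h
    by (rule integrable_compactly_supported[where R = R])
       (simp_all add: R continuous_on_mult continuous_on_of_real that schwartz_continuous \<phi>)
  from Bochner_Integration.integral_add[OF this[OF f] this[OF g]]
  show "U \<phi> + V \<phi> = (LINT x|lborel. complex_of_real (f x + g x) * \<phi> x)"
    using U V \<phi> by (simp add: represents_def distrib_right)
qed

lemma compactly_supported_affine:
  assumes "compactly_supported \<phi>" "\<bar>s\<bar> = 1"
  shows "compactly_supported (\<lambda>x. \<phi> (s * x + h))"
proof -
  obtain R where R: "\<And>x. \<bar>x\<bar> > R \<Longrightarrow> \<phi> x = 0"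
    using assms(1) unfolding compactly_supported_def by blast
  have "\<phi> (s * x + h) = 0" if "\<bar>x\<bar> > R + \<bar>h\<bar>" for x
  proof (rule R)
    have "\<bar>s * x\<bar> = \<bar>x\<bar>" by (simp add: abs_mult assms)
    then show "\<bar>s * x + h\<bar> > R" using that by linarith
  qed
  then show ?thesis unfolding compactly_supported_def by blast
qed

lemma abs_1_mult_self: "\<bar>s\<bar> = 1 \<Longrightarrow> s * s = (1::real)"
  by (metis abs_mult_self_eq mult_1)

text \<open>Composing test functions with x -> s x + h composes the represented function with the
  inverse map. That inverse is x -> s (x - h) since s s = 1, and |s| = 1 makes the Jacobian
  trivial.\<close>

lemma represents_affine:
  assumes U: "represents U f" and s: "\<bar>s\<bar> = 1"
  shows "represents (\<lambda>\<phi>. U (\<lambda>x. \<phi> (s * x + h))) (\<lambda>x. f (s * (x - h)))"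
  unfolding represents_def
proof (intro conjI ballI impI)
  show "tempered (\<lambda>\<phi>. U (\<lambda>x. \<phi> (s * x + h)))"
    using U s by (intro tempered_affine) (auto simp: represents_def)
  fix \<phi> assume \<phi>: "\<phi> \<in> schwartz" "compactly_supported \<phi>"
  have "U (\<lambda>x. \<phi> (s * x + h)) = (LINT x|lborel. complex_of_real (f x) * \<phi> (s * x + h))"
    using U schwartz_affine[OF \<phi>(1) s] compactly_supported_affine[OF \<phi>(2) s] unfolding represents_def by blast
  also have "\<dots> = \<bar>s\<bar> *\<^sub>R (LINT x|lborel. complex_of_real (f (- s * h + s * x)) * \<phi> (s * (- s * h + s * x) + h))"
    by (rule lborel_integral_real_affine) (use s in auto)
  also have "\<dots> = (LINT x|lborel. complex_of_real (f (s * (x - h))) * \<phi> x)"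
  proof -
    have "s * (- s * h + s * x) + h = x" for x
    proof -
      have "s * (- s * h + s * x) + h = s * s * (x - h) + h" by (simp add: algebra_simps)
      then show ?thesis by (simp add: abs_1_mult_self[OF s])
    qed
    moreover have "- s * h + s * x = s * (x - h)" for x by (simp add: algebra_simps)
    ultimately show ?thesis by (simp only: s scaleR_one)
  qed
  finally show "U (\<lambda>x. \<phi> (s * x + h)) = (LINT x|lborel. complex_of_real (f (s * (x - h))) * \<phi> x)" .
qed

lemma is_kernel_conv_add:
  "is_kernel_conv \<alpha> \<beta> W K \<Longrightarrow> is_kernel_conv \<alpha> \<beta> W' K' \<Longrightarrow>
    is_kernel_conv \<alpha> \<beta> (\<lambda>\<phi>. W \<phi> + W' \<phi>) (\<lambda>\<phi>. K \<phi> + K' \<phi>)"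
  by (simp add: is_kernel_conv_def tempered_add fourier_dist_def mult_dist_def)

lemma fourier_affine:
  assumes s: "\<bar>s\<bar> = 1"
  shows "fourier \<phi> (s * \<xi> + h) = fourier (\<lambda>y. cis (- (h * s) * y) * \<phi> (s * y)) \<xi>"
proof -
  have "fourier \<phi> (s * \<xi> + h) = \<bar>s\<bar> *\<^sub>R (LINT y|lborel. cis (- ((s * \<xi> + h) * (0 + s * y))) * \<phi> (0 + s * y))"
    unfolding fourier_def by (rule lborel_integral_real_affine) (use s in auto)
  also have "\<dots> = (LINT y|lborel. cis (- (\<xi> * y)) * (cis (- (h * s) * y) * \<phi> (s * y)))"
  proof -
    have "(s * \<xi> + h) * (0 + s * y) = (s * s) * (\<xi> * y) + h * s * y" for y by (simp add: algebra_simps)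
    then have "cis (- ((s * \<xi> + h) * (0 + s * y))) = cis (- (\<xi> * y)) * cis (- (h * s) * y)" for y
      by (simp add: abs_1_mult_self[OF s] cis_mult)
    then show ?thesis by (simp add: s mult.assoc)
  qed
  finally show ?thesis unfolding fourier_def .
qed

text \<open>On the Fourier side the substitution becomes a modulation by cis(- h s y) together with
  y -> s y. Multiplication by the symbol commutes with the modulation, and the symbol is unchanged
  under y -> s y because it is even.\<close>

lemma is_kernel_conv_affine:
  assumes WK: "is_kernel_conv \<alpha> \<beta> W K" and s: "\<bar>s\<bar> = 1"
  shows "is_kernel_conv \<alpha> \<beta> (\<lambda>\<phi>. W (\<lambda>x. \<phi> (s * x + h))) (\<lambda>\<phi>. K (\<lambda>x. \<phi> (s * x + h)))"
  unfolding is_kernel_conv_def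
proof (intro conjI ballI)
  show "tempered (\<lambda>\<phi>. K (\<lambda>x. \<phi> (s * x + h)))"
    using WK s by (intro tempered_affine) (auto simp: is_kernel_conv_def)
  fix \<phi> assume \<phi>: "\<phi> \<in> schwartz"
  define m where "m \<xi> = 1 / (1 + \<alpha> * \<xi>^2 + \<beta> * \<xi>^4)" for \<xi> :: real
  define \<psi> where "\<psi> y = cis (- (h * s) * y) * \<phi> (s * y)" for y
  have "(\<lambda>y. \<phi> (s * y + 0)) \<in> schwartz"
    by (rule schwartz_affine[OF \<phi> s])
  then have \<psi>: "\<psi> \<in> schwartz"
    unfolding \<psi>_def[abs_def] by (intro schwartz_mult moderate_cis) simp
  have "s^2 = 1" "s^4 = 1"
    using abs_1_mult_self[OF s] by (simp_all add: power2_eq_square power4_eq_xxxx)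
  then have m: "m (s * y) = m y" for y
    by (simp add: m_def power_mult_distrib)
  have "K (\<lambda>x. fourier \<phi> (s * x + h)) = K (fourier \<psi>)"
    by (simp add: fourier_affine[OF s] \<psi>_def[abs_def])
  also have "\<dots> = W (fourier (\<lambda>y. complex_of_real (m y) * \<psi> y))"
    using WK \<psi> by (simp add: is_kernel_conv_def fourier_dist_def mult_dist_def m_def)
  also have "(\<lambda>y. complex_of_real (m y) * \<psi> y) = (\<lambda>y. cis (- (h * s) * y) * (complex_of_real (m (s * y)) * \<phi> (s * y)))"
    by (simp add: m \<psi>_def mult.left_commute)
  also have "W (fourier \<dots>) = W (\<lambda>x. fourier (\<lambda>y. complex_of_real (m y) * \<phi> y) (s * x + h))"
    by (simp add: fourier_affine[OF s])
  finally show "fourier_dist (\<lambda>\<phi>. K (\<lambda>x. \<phi> (s * x + h))) \<phi> =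
      mult_dist (\<lambda>\<xi>. 1 / (1 + \<alpha> * \<xi>^2 + \<beta> * \<xi>^4)) (fourier_dist (\<lambda>\<phi>. W (\<lambda>x. \<phi> (s * x + h)))) \<phi>"
    by (simp add: fourier_dist_def mult_dist_def m_def)
qed

lemma schwartz_fourier_surj:
  assumes f: "f \<in> schwartz"
  obtains g where "g \<in> schwartz" "fourier g = f"
proof
  \<comment> \<open>The inverse Fourier transform of f, written as a reflected forward
    transform.\<close>
  let ?g = "\<lambda>\<xi>. complex_of_real (1 / (2 * pi)) * fourier f (- 1 * \<xi> + 0)"
  show "?g \<in> schwartz"
    by (intro schwartz_cmult schwartz_affine fourier_schwartz f) simp
  show "fourier ?g = f"
  proof
    fix x
    have eq: "fourier (fourier f) (- 1 * x + 0) = fourier (\<lambda>\<xi>. fourier f (- 1 * \<xi> + 0)) x"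
      by (subst fourier_affine) simp_all
    then show "fourier ?g x = f x"
      using fourier_fourier[OF f, of "- 1 * x + 0"] unfolding fourier_cmult by (simp add: field_simps)
  qed
qed

text \<open>If q were nonzero at \<open>x0\<close>, it would keep its sign on a neighbourhood;
  testing with a nonnegative bump supported there gives a nonzero integral.\<close>

lemma represents_0_imp_0:
  assumes U: "\<And>\<phi>. \<phi> \<in> schwartz \<Longrightarrow> compactly_supported \<phi> \<Longrightarrow> U \<phi> = 0"
    and rep: "represents U q" and q: "continuous_on UNIV q"
  shows "q x0 = 0"
proof (rule ccontr)
  assume nz: "q x0 \<noteq> 0"
  define \<sigma> where "\<sigma> = sgn (q x0)"
  have "isCont (\<lambda>x. \<sigma> * q x) x0"
    using q by (auto intro!: continuous_intros simp: continuous_on_eq_continuous_at)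
  then have "(\<lambda>x. \<sigma> * q x) \<midarrow>x0\<rightarrow> \<sigma> * q x0"
    by (simp add: isCont_def)
  moreover have pos: "\<sigma> * q x0 > 0" using nz by (simp add: \<sigma>_def sgn_if)
  ultimately have "\<forall>\<^sub>F x in at x0. \<sigma> * q x > 0" by (rule order_tendstoD)
  then obtain d where d: "d > 0" and d': "\<And>x. x \<noteq> x0 \<Longrightarrow> dist x x0 < d \<Longrightarrow> \<sigma> * q x > 0"
    by (auto simp: eventually_at)
  obtain r :: "real \<Rightarrow> real" where r: "smooth (\<lambda>x. complex_of_real (r x))" "\<And>x. r x \<ge> 0" "r 0 = 1"
      "\<And>x. \<bar>x\<bar> \<ge> 1 \<Longrightarrow> r x = 0"
    using bump_exists by blast
  \<comment> \<open>The bump is moved to \<open>x0\<close>, where it equals 1, and rescaled to the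
    radius d within which \<sigma> q is positive.\<close>
  define p where "p x = r (1 / d * x + - x0 / d)" for x
  have p0: "p x = 0" if "\<bar>x - x0\<bar> \<ge> d" for x
  proof -
    have "1 / d * x + - x0 / d = (x - x0) / d" using d by (simp add: field_simps)
    then show ?thesis unfolding p_def using that d by (intro r(4)) (simp add: abs_div le_divide_eq)
  qed
  have supp: "p x = 0" if "\<bar>x\<bar> > \<bar>x0\<bar> + d" for x
    by (rule p0) (use that in linarith)
  have sm: "smooth (\<lambda>x. complex_of_real (p x))"
    unfolding p_def by (rule smooth_affine[OF r(1)])
  have cs: "compactly_supported (\<lambda>x. complex_of_real (p x))"
    unfolding compactly_supported_def using supp by (intro exI[of _ "\<bar>x0\<bar> + d"]) auto
  have pc: "continuous_on UNIV p"
    using continuous_on_Re[OF smooth_continuous[OF sm]] by simp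
  let ?H = "\<lambda>x. \<sigma> * q x * p x"
  have Hc: "continuous_on UNIV ?H" by (intro continuous_intros q pc)
  have Hi: "integrable lborel ?H"
    by (rule integrable_compactly_supported[OF Hc, of "\<bar>x0\<bar> + d"]) (simp add: supp)
  have H0: "?H x \<ge> 0" for x
  proof (cases "\<bar>x - x0\<bar> \<ge> d")
    case False
    then have "\<sigma> * q x > 0" using d'[of x] pos by (cases "x = x0") (auto simp: dist_real_def)
    then show ?thesis using r(2) by (simp add: p_def)
  qed (simp add: p0)
  have "(LINT x|lborel. complex_of_real (q x) * complex_of_real (p x)) = 0"
    using rep U[OF compactly_supported_schwartz[OF sm cs] cs] compactly_supported_schwartz[OF sm cs] cs
    by (simp add: represents_def)
  then have "(LINT x|lborel. q x * p x) = 0"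
    by (simp flip: of_real_mult)
  then have "(LINT x|lborel. ?H x) = 0" by (simp add: mult.assoc)
  then have "AE x in lborel. ?H x = 0"
    using integral_nonneg_eq_0_iff_AE[OF Hi] H0 by auto
  \<comment> \<open>The zero set of the continuous function \<open>?H\<close> is closed, and a
    closed set of full Lebesgue measure is the whole line, so the identity extends from almost every
    point to \<open>x0\<close>.\<close>
  then have "AE x in lebesgue. ?H x = 0" by (rule AE_completion)
  moreover have "closed {x. ?H x = 0}"
    by (intro closed_Collect_eq Hc continuous_on_const)
  ultimately have "x0 \<in> {x. ?H x = 0}"
    by (intro mem_closed_if_AE_lebesgue) simp_all
  then show False using pos r(3) d by (auto simp: p_def)
qed

text \<open>Every Schwartz function is some \<open>fourier g\<close>, and there K equals W at the
  transform of the symbol times g. That argument is Schwartz but in general not compactly supported,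
  so the vanishing of W has to be extended by density first.\<close>

lemma kernel_conv_0:
  assumes "\<alpha> \<ge> 0" "\<beta> \<ge> 0" and W: "represents W (\<lambda>_. 0)" and WK: "is_kernel_conv \<alpha> \<beta> W K"
    and K: "represents K q" and q: "continuous_on UNIV q"
  shows "q x = 0"
proof (rule represents_0_imp_0[OF _ K q])
  fix \<phi> assume "\<phi> \<in> schwartz"
  then obtain g where g: "g \<in> schwartz" "fourier g = \<phi>" by (rule schwartz_fourier_surj)
  have "K (fourier g) = W (fourier (\<lambda>\<xi>. complex_of_real (1 / (1 + \<alpha> * \<xi>^2 + \<beta> * \<xi>^4)) * g \<xi>))"
    using WK g(1) by (simp add: is_kernel_conv_def fourier_dist_def mult_dist_def)
  also have "\<dots> = 0"
  proof (rule tempered_eq_0[of W])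
    show "tempered W" using W by (simp add: represents_def)
    show "W f = 0" if "f \<in> schwartz" "compactly_supported f" for f
      using W that by (simp add: represents_def)
    show "fourier (\<lambda>\<xi>. complex_of_real (1 / (1 + \<alpha> * \<xi>^2 + \<beta> * \<xi>^4)) * g \<xi>) \<in> schwartz"
      by (intro fourier_schwartz schwartz_mult moderate_multiplier assms g)
  qed
  finally show "K \<phi> = 0" by (simp add: g)
qed


section \<open>Symmetric solutions and travelling waves\<close>

lemma deriv_shift: "deriv (\<lambda>x. f (x + z)) x = deriv f (x + z :: real)"
  by (simp add: deriv_def DERIV_shift)

lemma deriv_iter_shift: "(deriv ^^ j) (\<lambda>x. f (x + z)) = (\<lambda>x. (deriv ^^ j) f (x + z :: real))"
  by (induction j) (auto simp: deriv_shift)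

lemma dx_has_derivative:
  assumes "smooth_solution_class T v" "t \<in> {0..T}" "j < 5"
  shows "(dx j v t has_real_derivative dx (Suc j) v t x) (at x)"
proof -
  have "dx (Suc j) v t x = deriv (dx j v t) x"
    by (simp add: dx_def[abs_def])
  then show ?thesis
    using assms unfolding smooth_solution_class_def by (auto simp: DERIV_deriv_iff_field_differentiable)
qed

lemma dx_reflect:
  assumes v: "smooth_solution_class T v" and t: "t \<in> {0..T}"
    and sym: "\<And>x. v t (z - x) = v t x" and "j \<le> 5"
  shows "dx j v t (z - x) = (-1) ^ j * dx j v t x"
  using \<open>j \<le> 5\<close>
proof (induction j arbitrary: x)
  case 0
  show ?case by (simp add: dx_def sym)
next
  case (Suc j)
  then have "j < 5" by simp
  note D = dx_has_derivative[OF v t this]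
  have "((\<lambda>x. dx j v t (z - x)) has_real_derivative dx (Suc j) v t (z - x) * (0 - 1)) (at x)"
    by (rule DERIV_chain2[OF D]) (auto intro!: derivative_eq_intros)
  moreover have "((\<lambda>x. dx j v t (z - x)) has_real_derivative (-1) ^ j * dx (Suc j) v t x) (at x)"
    using Suc D by (auto intro!: derivative_eq_intros)
  ultimately have "dx (Suc j) v t (z - x) * (0 - 1) = (-1) ^ j * dx (Suc j) v t x"
    by (rule DERIV_unique)
  then show ?case by simp
qed

text \<open>The undifferentiated factor v^m in the nonlinear term is even about the axis for every
  m, so it does not affect the parity.\<close>

lemma flux_reflect:
  assumes v: "smooth_solution_class T v" and t: "t \<in> {0..T}"
    and sym: "\<And>x. v t (z - x) = v t x"
  shows "flux a b \<kappa> \<mu> m v t (z - x) = - flux a b \<kappa> \<mu> m v t x"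
proof -
  have odd: "dx j v t (z - x) = - dx j v t x" if "odd j" "j \<le> 5" for j
    using dx_reflect[OF v t, OF sym that(2)] that(1) by simp
  have "dx 1 v t (z - x) = - dx 1 v t x" "dx 3 v t (z - x) = - dx 3 v t x" "dx 5 v t (z - x) = - dx 5 v t x"
    by (intro odd; simp)+
  then show ?thesis
    unfolding flux_def sym by simp
qed

lemma dx_continuous_on:
  assumes "smooth_solution_class T v" "t \<in> {0..T}" "j \<le> 5"
  shows "continuous_on S (dx j v t)"
proof -
  have "continuous_on ({0..T} \<times> UNIV) (\<lambda>(t, x). dx j v t x)"
    using assms unfolding smooth_solution_class_def by blast
  then have "continuous_on S ((\<lambda>(t, x). dx j v t x) \<circ> (\<lambda>x. (t, x)))"
    by (intro continuous_on_compose) (use assms in \<open>auto intro!: continuous_intros elim!: continuous_on_subset\<close>)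
  then show ?thesis by (simp add: o_def)
qed

lemma dx_0: "dx 0 v = v"
  by (simp add: dx_def fun_eq_iff)

lemma flux_continuous_on:
  assumes "smooth_solution_class T v" "t \<in> {0..T}"
  shows "continuous_on S (flux a b \<kappa> \<mu> m v t)"
  using dx_continuous_on[OF assms, of 0 S] dx_continuous_on[OF assms, of 1 S]
    dx_continuous_on[OF assms, of 3 S] dx_continuous_on[OF assms, of 5 S]
  unfolding flux_def[abs_def] dx_0 by (intro continuous_intros) auto

section \<open>Time derivatives\<close>

lemma dt_has_vector_derivative:
  assumes "smooth_solution_class T v" "t \<in> {0..T}"
  shows "((\<lambda>s. v s x) has_vector_derivative dt T v t x) (at t within {0..T})"
proof -
  have "(\<lambda>s. dx 0 v s x) differentiable (at t within {0..T})"
    using assms unfolding smooth_solution_class_def by blast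
  then show ?thesis
    by (simp add: dx_0 dt_def vector_derivative_works)
qed

text \<open>T > 0 makes the derivative within [0, T] unique, including the one-sided derivatives at
  the end points; t = 0 is the time used in the theorem.\<close>

lemma dt_eqI:
  assumes "T > 0" "t \<in> {0..T}" "((\<lambda>s. v s x) has_vector_derivative D) (at t within {0..T})"
  shows "dt T v t x = D"
  using vector_derivative_within_cbox[of 0 T t "\<lambda>s. v s x" D] assms by (simp add: dt_def)

text \<open>The solution class provides only partial derivatives, the one in time taken within
  [0, T]. Joint continuity of v_x upgrades them to total differentiability within the strip, after
  which the chain rule applies.\<close>

lemma has_vector_derivative_along_curve:
  assumes v: "smooth_solution_class T v" and t: "t \<in> {0..T}"
    and \<gamma>: "(\<gamma> has_real_derivative c) (at t)"
  shows "((\<lambda>s. v s (\<gamma> s)) has_vector_derivative dt T v t (\<gamma> t) + c * dx 1 v t (\<gamma> t)) (at t within {0..T})"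
proof -
  let ?X = "{0..T} \<times> (UNIV :: real set)"
  have cont: "continuous_on ?X (\<lambda>(t, x). dx 1 v t x)"
    using v unfolding smooth_solution_class_def by simp
  have "((\<lambda>(s, x). v s x) has_derivative
      (\<lambda>(h, k). h *\<^sub>R dt T v t (\<gamma> t) + blinfun_scaleR_left (dx 1 v t (\<gamma> t)) k)) (at (t, \<gamma> t) within ?X)"
  proof (rule has_derivative_partialsI[where fy = "\<lambda>s x. blinfun_scaleR_left (dx 1 v s x)"])
    show "((\<lambda>s. v s (\<gamma> t)) has_derivative (\<lambda>h. h *\<^sub>R dt T v t (\<gamma> t))) (at t within {0..T})"
      using dt_has_vector_derivative[OF v t] by (simp add: has_vector_derivative_def)
    show "(v s has_derivative blinfun_apply (blinfun_scaleR_left (dx 1 v s x))) (at x within UNIV)"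
      if "s \<in> {0..T}" for s x
    proof (rule has_derivative_eq_rhs)
      show "(v s has_derivative (*) (dx 1 v s x)) (at x)"
        using dx_has_derivative[OF v that, of 0 x] by (simp add: dx_0 has_field_derivative_def)
    qed (simp add: fun_eq_iff)
    have "continuous_on ?X (\<lambda>p. blinfun_scaleR_left (case p of (s, x) \<Rightarrow> dx 1 v s x))"
      by (intro bounded_linear.continuous_on[OF bounded_linear_blinfun_scaleR_left] cont)
    then show "continuous (at (t, \<gamma> t) within ?X) (\<lambda>(s, x). blinfun_scaleR_left (dx 1 v s x))"
      using t by (simp add: continuous_on_eq_continuous_within case_prod_beta')
  qed auto
  moreover have "((\<lambda>s. (s, \<gamma> s)) has_derivative (\<lambda>h. (h, c * h))) (at t within {0..T})"
    using has_derivative_at_withinI[OF \<gamma>[unfolded has_field_derivative_def]]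
    by (intro has_derivative_Pair has_derivative_ident)
  ultimately have "((\<lambda>s. case (s, \<gamma> s) of (s, x) \<Rightarrow> v s x) has_derivative
      (\<lambda>h. case (h, c * h) of (h, k) \<Rightarrow> h *\<^sub>R dt T v t (\<gamma> t) + blinfun_scaleR_left (dx 1 v t (\<gamma> t)) k)) (at t within {0..T})"
    by (intro has_derivative_in_compose[where g = "\<lambda>(s, x). v s x" and f = "\<lambda>s. (s, \<gamma> s)"])
       (auto elim: has_derivative_subset)
  then show ?thesis
    by (simp add: has_vector_derivative_def algebra_simps)
qed

lemma symmetric_wave_identity:
  assumes "\<alpha> \<ge> 0" "\<beta> \<ge> 0" "T > 0"
    and v: "smooth_solution_class T v" and sym: "spatially_symmetric T v lam" and t: "t \<in> {0..T}"
    and W: "represents W (flux a b \<kappa> \<mu> m v t)" and WK: "is_kernel_conv \<alpha> \<beta> W K"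
    and K: "represents K q" and q: "continuous_on UNIV q" and eq: "\<And>x. dt T v t x + q x = 0"
  shows "q x = deriv lam t * dx 1 v t x"
proof -
  define z where "z = 2 * lam t"
  have refl: "v t (z - x) = v t x" for x
    using sym t unfolding spatially_symmetric_def z_def by metis
  let ?f = "flux a b \<kappa> \<mu> m v t"
  have f: "continuous_on UNIV ?f" by (rule flux_continuous_on[OF v t])
  \<comment> \<open>With s = -1 and h = z the affine map is the reflection about z / 2, which is the
    axis at time t; the sum represents the flux plus its reflection.\<close>
  have "represents (\<lambda>\<phi>. W \<phi> + W (\<lambda>x. \<phi> (- 1 * x + z))) (\<lambda>x. ?f x + ?f (- 1 * (x - z)))"
    by (intro represents_add represents_affine W f continuous_on_compose2[OF f] continuous_intros) auto
  then have W0: "represents (\<lambda>\<phi>. W \<phi> + W (\<lambda>x. \<phi> (- 1 * x + z))) (\<lambda>_. 0)"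
    using flux_reflect[OF v t, OF refl] by simp
  have K0: "represents (\<lambda>\<phi>. K \<phi> + K (\<lambda>x. \<phi> (- 1 * x + z))) (\<lambda>x. q x + q (- 1 * (x - z)))"
    by (intro represents_add represents_affine K q continuous_on_compose2[OF q] continuous_intros) auto
  have "q x + q (- 1 * (x - z)) = 0"
  proof (rule kernel_conv_0[OF assms(1,2) W0 _ K0])
    show "is_kernel_conv \<alpha> \<beta> (\<lambda>\<phi>. W \<phi> + W (\<lambda>x. \<phi> (- 1 * x + z))) (\<lambda>\<phi>. K \<phi> + K (\<lambda>x. \<phi> (- 1 * x + z)))"
      by (intro is_kernel_conv_add is_kernel_conv_affine WK) simp
    show "continuous_on UNIV (\<lambda>x. q x + q (- 1 * (x - z)))"
      by (intro continuous_on_add q continuous_on_compose2[OF q] continuous_intros) auto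
  qed
  then have q_odd: "q (z - x) = - q x" by simp
  have "lam differentiable at t"
    using sym by (auto simp: spatially_symmetric_def C1_differentiable_on_eq)
  then have "(lam has_real_derivative deriv lam t) (at t)"
    by (simp add: DERIV_deriv_iff_real_differentiable)
  then have "((\<lambda>s. 2 * lam s - x) has_real_derivative 2 * deriv lam t) (at t)"
    by (auto intro!: derivative_eq_intros)
  from has_vector_derivative_along_curve[OF v t this]
  \<comment> \<open>On [0, T] the functions v(s, 2 lam(s) - x) and v(s, x) of s coincide by
    symmetry, so the derivative along the moving reflected point is the time derivative at
    x.\<close>
  have "((\<lambda>s. v s x) has_vector_derivative dt T v t (z - x) + 2 * deriv lam t * dx 1 v t (z - x)) (at t within {0..T})"
    unfolding z_def
    by (rule has_vector_derivative_transform[OF t, rotated])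
       (use sym in \<open>unfold spatially_symmetric_def, blast\<close>)
  then have "dt T v t x = dt T v t (z - x) + 2 * deriv lam t * dx 1 v t (z - x)"
    by (rule dt_eqI[OF \<open>T > 0\<close> t])
  moreover have "dx 1 v t (z - x) = - dx 1 v t x"
    using dx_reflect[OF v t, OF refl, of 1 x] by simp
  ultimately show ?thesis
    using eq[of x] eq[of "z - x"] q_odd by simp
qed

text \<open>The wave has time derivative -c v_x(0, x - c t), and translation invariance makes its
  convolution term q(x - c t). The two cancel at every t because q = c v_x holds at time 0; this
  identity is used at no other time.\<close>

lemma travelling_wave_solution:
  assumes "T > 0" and v: "smooth_solution_class T v" and M: "\<And>x. \<bar>v 0 x\<bar> \<le> M"
    and W: "represents W (flux a b \<kappa> \<mu> m v 0)" and WK: "is_kernel_conv \<alpha> \<beta> W K"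
    and K: "represents K q" and q: "continuous_on UNIV q" and eq: "\<And>x. q x = c * dx 1 v 0 x"
  shows "classical_solution a b \<kappa> \<mu> \<alpha> \<beta> m T (\<lambda>t x. v 0 (x - c * t))"
proof -
  define w where "w t x = v 0 (x - c * t)" for t x
  have 0: "0 \<in> {0..T}" using \<open>T > 0\<close> by simp
  have dxw: "dx j w = (\<lambda>t x. dx j v 0 (x - c * t))" for j
    using deriv_iter_shift[of j "v 0" "- (c * t)" for t] by (simp add: dx_def w_def[abs_def] fun_eq_iff)
  have D: "(dx j v 0 has_real_derivative dx (Suc j) v 0 x) (at x)" if "j < 5" for j x
    by (rule dx_has_derivative[OF v 0 that])
  have Dt: "((\<lambda>s. dx j w s x) has_vector_derivative - c * dx (Suc j) v 0 (x - c * t)) (at t within {0..T})"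
    if "j < 5" for j t x
  proof -
    have "((\<lambda>s. x - c * s) has_real_derivative - c) (at t)"
      by (auto intro!: derivative_eq_intros)
    from DERIV_chain2[OF D[OF that] this]
    have "((\<lambda>s. dx j v 0 (x - c * s)) has_real_derivative - c * dx (Suc j) v 0 (x - c * t)) (at t)"
      by (simp only: mult.commute[of "- c"])
    then show ?thesis
      unfolding dxw has_real_derivative_iff_has_vector_derivative by (rule has_vector_derivative_at_within)
  qed
  have dtw: "dt T (dx j w) t x = - c * dx (Suc j) v 0 (x - c * t)" if "t \<in> {0..T}" "j < 5" for j t x
    using dt_eqI[OF \<open>T > 0\<close> that(1) Dt[OF that(2)]] .
  have cont: "continuous_on S (\<lambda>(t, x). dx j v 0 (x - c * t))" if "j \<le> 5" for S j
    unfolding case_prod_beta'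
    by (rule continuous_on_compose2[OF dx_continuous_on[OF v 0 that, of UNIV]]) (auto intro!: continuous_intros)
  have "smooth_solution_class T w"
    unfolding smooth_solution_class_def
  proof (intro conjI allI impI ballI)
    show "dx j w t field_differentiable at x" if "j < 5" for j t x
      using D[OF that, of "x + - (c * t)"] unfolding DERIV_shift dxw field_differentiable_def by auto
    show "continuous_on ({0..T} \<times> UNIV) (\<lambda>(t, x). dx j w t x)" if "j \<le> 5" for j
      unfolding dxw by (rule cont[OF that])
    show "(\<lambda>s. dx j w s x) differentiable at t within {0..T}" if "j \<le> 4" for j t x
      using Dt[of j x t] that by (auto intro: differentiableI_vector)
    show "continuous_on ({0..T} \<times> UNIV) (\<lambda>(t, x). dt T (dx j w) t x)" if "j \<le> 4" for j
    proof -
      have "continuous_on ({0..T} \<times> UNIV) (\<lambda>p. - c * (case p of (t, x) \<Rightarrow> dx (Suc j) v 0 (x - c * t)))"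
        using that by (intro continuous_on_mult_left cont) simp
      then show ?thesis
        by (rule continuous_on_eq) (use that dtw in auto)
    qed
  qed
  moreover have "\<exists>W K q. represents W (flux a b \<kappa> \<mu> m w t) \<and> is_kernel_conv \<alpha> \<beta> W K \<and>
      continuous_on UNIV q \<and> represents K q \<and> (\<forall>x. dt T w t x + q x = 0)" if t: "t \<in> {0..T}" for t
  proof (intro exI conjI allI)
    \<comment> \<open>The flux has no explicit dependence on x, so at time t it is the initial flux
      shifted by c t; the factor 1 is the s of the affine lemmas.\<close>
    have "flux a b \<kappa> \<mu> m w t = (\<lambda>x. flux a b \<kappa> \<mu> m v 0 (1 * (x - c * t)))"
      by (simp add: flux_def dxw w_def fun_eq_iff)
    then show "represents (\<lambda>\<phi>. W (\<lambda>x. \<phi> (1 * x + c * t))) (flux a b \<kappa> \<mu> m w t)"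
      using represents_affine[OF W, of 1 "c * t"] by simp
    show "is_kernel_conv \<alpha> \<beta> (\<lambda>\<phi>. W (\<lambda>x. \<phi> (1 * x + c * t))) (\<lambda>\<phi>. K (\<lambda>x. \<phi> (1 * x + c * t)))"
      by (intro is_kernel_conv_affine WK) simp
    show "represents (\<lambda>\<phi>. K (\<lambda>x. \<phi> (1 * x + c * t))) (\<lambda>x. q (1 * (x - c * t)))"
      by (intro represents_affine K) simp
    show "continuous_on UNIV (\<lambda>x. q (1 * (x - c * t)))"
      by (intro continuous_on_compose2[OF q] continuous_intros) auto
    show "dt T w t x + q (1 * (x - c * t)) = 0" for x
      using dtw[OF t, of 0 x] by (simp add: dx_0 eq)
  qed
  moreover have "\<exists>M. \<forall>t\<in>{0..T}. \<forall>x. \<bar>w t x\<bar> \<le> M"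
    using M by (auto simp: w_def)
  ultimately have "classical_solution a b \<kappa> \<mu> \<alpha> \<beta> m T w"
    unfolding classical_solution_def by blast
  then show ?thesis by (simp add: w_def[abs_def])
qed

theorem theorem3p2:
  fixes a b \<kappa> \<mu> \<alpha> \<beta> T :: real
    and m :: nat
    and v :: "real \<Rightarrow> real \<Rightarrow> real"
    and lam :: "real \<Rightarrow> real"
  assumes "\<alpha> \<ge> 0" and "\<beta> \<ge> 0" and "m > 0" and "T > 0"
    and "at_most_one_classical_solution a b \<kappa> \<mu> \<alpha> \<beta> m T"
    and "classical_solution a b \<kappa> \<mu> \<alpha> \<beta> m T v"
    and "spatially_symmetric T v lam"
  shows "steady T v (deriv lam 0)"
proof -
  have 0: "0 \<in> {0..T}" using \<open>T > 0\<close> by simp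
  have v: "smooth_solution_class T v"
    using assms(6) unfolding classical_solution_def by blast
  obtain M where M: "\<And>t x. t \<in> {0..T} \<Longrightarrow> \<bar>v t x\<bar> \<le> M"
    using assms(6) unfolding classical_solution_def by blast
  obtain W K q where W: "represents W (flux a b \<kappa> \<mu> m v 0)" "is_kernel_conv \<alpha> \<beta> W K"
    and K: "represents K q" "continuous_on UNIV q" and eq: "\<And>x. dt T v 0 x + q x = 0"
    using assms(6) 0 unfolding classical_solution_def by blast
  have "classical_solution a b \<kappa> \<mu> \<alpha> \<beta> m T (\<lambda>t x. v 0 (x - deriv lam 0 * t))"
  proof (rule travelling_wave_solution[OF \<open>T > 0\<close> v _ W K])
    show "\<bar>v 0 x\<bar> \<le> M" for x by (rule M[OF 0])
    show "q x = deriv lam 0 * dx 1 v 0 x" for x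
      by (rule symmetric_wave_identity[OF assms(1,2,4) v assms(7) 0 W K eq])
  qed
  \<comment> \<open>At t = 0 the wave is v(0, x), so both solutions have the same initial data; the
    profile g is v(0, x) itself.\<close>
  with assms(6) have "\<forall>t\<in>{0..T}. \<forall>x. v t x = v 0 (x - deriv lam 0 * t)"
    by (intro assms(5)[unfolded at_most_one_classical_solution_def, THEN spec[of _ "v 0"], THEN spec[of _ v],
          THEN spec[of _ "\<lambda>t x. v 0 (x - deriv lam 0 * t)"], THEN mp]) simp
  then show ?thesis unfolding steady_def by blast
qed


end
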